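(* Let $\mathcal{X}$ be a finite field. For every $R>0$ there exists a sequence $\{(\Phi^{(n)},\Psi^{(n)})\}_{n=1}^{\infty}$, where for each $n$ the pair $(\Phi^{(n)},\Psi^{(n)})$ is a variable-length source encryption scheme of block length $n$, such that for every $(p_X,p_K)\in\mathcal{P}(\mathcal{X})\times\mathcal{P}(\mathcal{X})$ with $H(X)<R<H(K)$, $$\limsup_{n\to\infty}\frac1n\overline{L}_{\Phi^{(n)}}\le R$$ and $$\liminf_{n\to\infty}\left(-\frac1n\right)\log\Delta_{\mathrm{MI}}^{(n)}(\Phi^{(n)}|p_X^n,p_K^n)\ge\min\{E(R|p_X),F(R|p_K)\}>0.$$
   Context: All logarithms are to base 2, $\mathbb{N}=\{1,2,\ldots\}$, and $[a]^+:=\max\{0,a\}$. $\mathcal{P}(\mathcal{X})$ is the set of probability distributions on $\mathcal{X}$; $H(P)$ is Shannon entropy, $D(P\|Q)$ is relative entropy, and $I(\cdot;\cdot)$ is mutual information. $H(X)$ and $H(K)$ are the entropies of $p_X$ and $p_K$. Source and key: given $p_X,p_K\in\mathcal{P}(\mathcal{X})$, $\boldsymbol{X}=X_1\cdots X_n$ is i.i.d. with law $p_X$, $\boldsymbol{K}=K_1\cdots K_n$ is i.i.d. with law $p_K$, and $\boldsymbol{X}$ and $\boldsymbol{K}$ are independent; $p_X^n$ and $p_K^n$ denote the corresponding product laws on $\mathcal{X}^n$. Scheme: let $\mathcal{Y}=\{0,1\}$ and $\mathcal{Y}^*=\bigcup_{l\in\mathbb{N}}\mathcal{Y}^l$, and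 let $|y|$ be the length of $y\in\mathcal{Y}^*$. A variable-length source encryption scheme of block length $n$ is a pair of maps $\Phi^{(n)}:\mathcal{X}^n\times\mathcal{X}^n\to\mathcal{Y}^*$, $\Psi^{(n)}:\mathcal{X}^n\times\mathcal{Y}^*\to\mathcal{X}^n$, written $\Phi_{\boldsymbol{k}}^{(n)}(\boldsymbol{x})=\Phi^{(n)}(\boldsymbol{k},\boldsymbol{x})$ and $\Psi_{\boldsymbol{k}}^{(n)}(c)=\Psi^{(n)}(\boldsymbol{k},c)$, with $\Psi_{\boldsymbol{k}}^{(n)}(\Phi_{\boldsymbol{k}}^{(n)}(\boldsymbol{x}))=\boldsymbol{x}$ for all $\boldsymbol{k},\boldsymbol{x}\in\mathcal{X}^n$. The ciphertext is $C^{(n)}=\Phi_{\boldsymbol{K}}^{(n)}(\boldsymbol{X})$. The average codeword length is $\overline{L}_{\Phi^{(n)}}=\mathrm{E}\left[|\Phi_{\boldsymbol{K}}^{(n)}(\boldsymbol{X})|\right]=\sum_{\boldsymbol{k}}p_K^n(\boldsymbol{k})\,\mathrm{E}\left[|\Phi_{\boldsymbol{k}}^{(n)}(\boldsymbol{X})|\right]$. The security measure is $\Delta_{\mathrm{MI}}^{(n)}(\Phi^{(n)}|p_X^n,p_K^n)=I(C^{(n)};\boldsymbol{X})$, with $-\log0=+\infty$. Exponents: for $R\ge0$, $$E(R|p_X)=\min_{P\in\mathcal{P}(\mathcal{X}):\,R\le H(P)}D(P\|p_X),\qquad F(R|p_K)=\min_{P\in\mathcal{P}(\mathcal{X})}\left\{[H(P)-R]^++D(P\|p_K)\right\},$$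 where the minimum over an empty set is $+\infty$. *)

theory Defs
  imports "HOL-Probability.Probability"
begin

definition shannon_entropy :: "'a pmf \<Rightarrow> real" where
  "shannon_entropy P = prob_space.entropy (measure_pmf P) 2 (count_space UNIV) (\<lambda>x. x)"

text \<open>
  The real-valued divergence of the library is only meaningful if \<open>P\<close> is absolutely continuous
  with respect to \<open>Q\<close>. Note also its argument order: the reference measure comes first.
\<close>

definition rel_entropy :: "'a pmf \<Rightarrow> 'a pmf \<Rightarrow> ereal" where
  "rel_entropy P Q =
     (if set_pmf P \<subseteq> set_pmf Q then ereal (KL_divergence 2 (measure_pmf Q) (measure_pmf P)) else \<infinity>)"

lemma rel_entropy_eq_sum:
  fixes P Q :: "'a :: finite pmf"
  assumes "set_pmf P \<subseteq> set_pmf Q"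
  shows "rel_entropy P Q = ereal (\<Sum>x\<in>UNIV. pmf P x * log 2 (pmf P x / pmf Q x))"
proof -
  interpret sigma_finite_measure "count_space (UNIV :: 'a set)"
    by (simp add: sigma_finite_measure_count_space_finite)
  have "pmf Q x = 0 \<Longrightarrow> pmf P x = 0" for x
    using assms by (auto simp: set_pmf_eq)
  then have "KL_divergence 2 (density (count_space UNIV) (pmf Q)) (density (count_space UNIV) (pmf P)) =
      (\<integral>x. pmf P x * log 2 (pmf P x / pmf Q x) \<partial>count_space UNIV)"
    by (intro KL_density_density) auto
  then show ?thesis
    using assms by (simp add: rel_entropy_def measure_pmf_eq_density[symmetric]
        lebesgue_integral_count_space_finite)
qed

lemma shannon_entropy_eq_sum:
  fixes P :: "'a :: finite pmf"
  shows "shannon_entropy P = - (\<Sum>x\<in>UNIV. pmf P x * log 2 (pmf P x))"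
proof -
  interpret C: sigma_finite_measure "count_space (UNIV :: 'a set)"
    by (simp add: sigma_finite_measure_count_space_finite)
  have "KL_divergence 2 (count_space UNIV) (density (count_space UNIV) (pmf P)) =
      (\<integral>x. pmf P x * log 2 (pmf P x) \<partial>count_space UNIV)"
    by (intro C.KL_density) auto
  moreover have "distr (measure_pmf P) (count_space UNIV) (\<lambda>x. x) = measure_pmf P"
    by (intro distr_id2) simp
  ultimately show ?thesis
    by (simp add: shannon_entropy_def prob_space.entropy_def[OF prob_space_measure_pmf] measure_pmf_eq_density[symmetric]
        lebesgue_integral_count_space_finite)
qed

text \<open>
  Elements of $\mathcal{X}^n$ are the lists of length \<open>n\<close>, and \<open>replicate_pmf n p\<close> is the product law
  of \<open>p\<close> on them. A codeword is a nonempty bit string. What the two maps do outside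
  $\mathcal{X}^n$ and on the empty bit string is left unconstrained.
\<close>

definition is_scheme ::
  "nat \<Rightarrow> ('a list \<Rightarrow> 'a list \<Rightarrow> bool list) \<Rightarrow> ('a list \<Rightarrow> bool list \<Rightarrow> 'a list) \<Rightarrow> bool" where
  "is_scheme n \<Phi> \<Psi> \<longleftrightarrow>
     (\<forall>k x. length k = n \<longrightarrow> length x = n \<longrightarrow> \<Phi> k x \<noteq> []) \<and>
     (\<forall>k c. length k = n \<longrightarrow> c \<noteq> [] \<longrightarrow> length (\<Psi> k c) = n) \<and>
     (\<forall>k x. length k = n \<longrightarrow> length x = n \<longrightarrow> \<Psi> k (\<Phi> k x) = x)"

definition key_source :: "nat \<Rightarrow> 'a pmf \<Rightarrow> 'a pmf \<Rightarrow> ('a list \<times> 'a list) pmf" where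
  "key_source n pK pX = pair_pmf (replicate_pmf n pK) (replicate_pmf n pX)"

definition avg_length ::
  "nat \<Rightarrow> ('a list \<Rightarrow> 'a list \<Rightarrow> bool list) \<Rightarrow> 'a pmf \<Rightarrow> 'a pmf \<Rightarrow> real" where
  "avg_length n \<Phi> pX pK =
     measure_pmf.expectation (key_source n pK pX) (\<lambda>(k, x). real (length (\<Phi> k x)))"

definition Delta_MI ::
  "nat \<Rightarrow> ('a list \<Rightarrow> 'a list \<Rightarrow> bool list) \<Rightarrow> 'a pmf \<Rightarrow> 'a pmf \<Rightarrow> real" where
  "Delta_MI n \<Phi> pX pK =
     prob_space.mutual_information (measure_pmf (key_source n pK pX)) 2
       (count_space UNIV) (count_space UNIV) (\<lambda>(k, x). \<Phi> k x) (\<lambda>(k, x). x)"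

lemma Delta_MI_eq_KL:
  fixes \<Phi> :: "'a :: finite list \<Rightarrow> 'a list \<Rightarrow> bool list"
    and pX pK :: "'a pmf" and n :: nat
  defines "J \<equiv> map_pmf (\<lambda>(k, x). (\<Phi> k x, x)) (key_source n pK pX)"
  shows "Delta_MI n \<Phi> pX pK =
    KL_divergence 2 (measure_pmf (pair_pmf (map_pmf fst J) (map_pmf snd J))) (measure_pmf J)"
proof -
  have pair: "measure_pmf p \<Otimes>\<^sub>M measure_pmf q = measure_pmf (pair_pmf p q)"
    for p :: "bool list pmf" and q :: "'a list pmf"
  proof (rule pair_measure_eqI)
    show "sigma_finite_measure (measure_pmf p)" "sigma_finite_measure (measure_pmf q)"
      by unfold_locales
    have "sets (measure_pmf p \<Otimes>\<^sub>M measure_pmf q) =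
        sets (count_space (UNIV :: bool list set) \<Otimes>\<^sub>M count_space (UNIV :: 'a list set))"
      by (intro sets_pair_measure_cong) auto
    also have "\<dots> = UNIV"
      by (subst pair_measure_countable) auto
    finally show "sets (measure_pmf p \<Otimes>\<^sub>M measure_pmf q) = sets (measure_pmf (pair_pmf p q))"
      by simp
    show "emeasure (measure_pmf p) A * emeasure (measure_pmf q) B =
        emeasure (measure_pmf (pair_pmf p q)) (A \<times> B)" for A B
      by (simp add: measure_pmf.emeasure_eq_measure measure_pmf_prob_product ennreal_mult
          measure_nonneg)
  qed
  have "distr (measure_pmf (key_source n pK pX)) (count_space UNIV) (\<lambda>(k, x). \<Phi> k x) =
      measure_pmf (map_pmf fst J)"
    by (simp add: J_def map_pmf_rep_eq[symmetric] map_pmf_comp case_prod_unfold)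
  moreover have "distr (measure_pmf (key_source n pK pX)) (count_space UNIV) (\<lambda>(k, x). x) =
      measure_pmf (map_pmf snd J)"
    by (simp add: J_def map_pmf_rep_eq[symmetric] map_pmf_comp case_prod_unfold)
  moreover have "distr (measure_pmf (key_source n pK pX)) (count_space UNIV \<Otimes>\<^sub>M count_space UNIV)
      (\<lambda>z. ((\<lambda>(k, x). \<Phi> k x) z, (\<lambda>(k, x). x) z)) = measure_pmf J"
    by (simp add: J_def map_pmf_rep_eq[symmetric] pair_measure_countable[OF countableI_type countableI_type] case_prod_unfold)
  ultimately show ?thesis
    by (simp add: Delta_MI_def prob_space.mutual_information_def[OF prob_space_measure_pmf] pair)
qed

text \<open>The convention is $-\log 0 = +\infty$, whereas \<open>log 2 0 = 0\<close> in the library.\<close>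

definition neg_log2 :: "real \<Rightarrow> ereal" where
  "neg_log2 t = (if t = 0 then \<infinity> else ereal (- log 2 t))"

text \<open>
  On a finite alphabet both infima are attained (the set of distributions is compact and the
  objective lower semicontinuous), so they are minima; over the empty set the infimum is \<open>\<infinity>\<close>.
\<close>

definition exponent_E :: "real \<Rightarrow> 'a pmf \<Rightarrow> ereal" where
  "exponent_E R pX = (INF P\<in>{P. R \<le> shannon_entropy P}. rel_entropy P pX)"

definition exponent_F :: "real \<Rightarrow> 'a pmf \<Rightarrow> ereal" where
  "exponent_F R pK = (INF P. ereal (max 0 (shannon_entropy P - R)) + rel_entropy P pK)"

end

theory Submission
  imports Defs "HOL-Real_Asymp.Real_Asymp"
begin

text \<open>
  Sequences whose type has entropy below \<open>R\<close> number at most about \<open>2 powr (n * R)\<close>; they are indexed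
  by strings of \<open>m\<close> bits with \<open>m\<close> close to \<open>n * R\<close> and masked by the exclusive or with a hash of the
  key. All other sequences are sent in clear, behind a flag bit; under $p_X^n$ they have probability
  at most a polynomial times \<open>2 powr (- n * E)\<close>, so they contribute little to the length and to the
  leakage.

  The leakage of the masked part is the divergence of the hashed key from the uniform law. By
  convexity it is at most the average, over the type of the key, of the same divergence for a key
  uniform on a type class \<open>T\<close>, and for a random hash function the latter is of order \<open>2 ^ m / card T\<close> in
  mean. There are only polynomially many types, so one hash function is good for all of them at once,
  whatever $p_K$ is. The factor \<open>card T\<close> in the probability of the class cancels, which leaves
  \<open>2 powr (- n * (max 0 (H P - R) + D P))\<close> for each type \<open>P\<close>, that is, the exponent \<open>F\<close>.
\<close>

section \<open>Logarithmic inequalities\<close>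

text \<open>This is \<open>ln u \<le> u - 1\<close> at \<open>u = a / b\<close>, multiplied by
  \<open>b\<close>. The Gibbs inequality, Jensen's inequality and the Hellinger bound below all rest
  on this pointwise form.\<close>

lemma diff_le_mult_ln:
  fixes a b :: real
  assumes "0 < a" "0 \<le> b"
  shows "b - a \<le> b * ln (b / a)"
proof (cases "b = 0")
  case True
  then show ?thesis using assms by simp
next
  case False
  then have "0 < b" using assms by simp
  then have "ln (a / b) \<le> a / b - 1"
    using assms by (intro ln_le_minus_one) simp
  then have "b * ln (a / b) \<le> b * (a / b - 1)"
    using \<open>0 < b\<close> by (intro mult_left_mono) auto
  then show ?thesis
    using assms \<open>0 < b\<close> by (simp add: ln_div algebra_simps)
qed

text \<open>Summing the pointwise bound leaves the difference of the total masses, so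
  \<open>q\<close> may have smaller mass than \<open>p\<close>. This covers a reference law that is
  restricted to a finite support.\<close>

lemma gibbs_inequality:
  fixes p q :: "'a \<Rightarrow> real"
  assumes "\<And>x. x \<in> A \<Longrightarrow> 0 \<le> p x" "\<And>x. x \<in> A \<Longrightarrow> 0 < q x" "sum q A \<le> sum p A"
  shows "0 \<le> (\<Sum>x\<in>A. p x * log 2 (p x / q x))"
proof -
  have "0 \<le> (\<Sum>x\<in>A. p x - q x)"
    using assms(3) by (simp add: sum_subtractf)
  also have "\<dots> \<le> (\<Sum>x\<in>A. p x * ln (p x / q x))"
    using assms by (intro sum_mono diff_le_mult_ln) auto
  finally have "0 \<le> (\<Sum>x\<in>A. p x * ln (p x / q x)) / ln 2"
    by simp
  then show ?thesis by (simp add: log_def sum_divide_distrib)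
qed

text \<open>Jensen's inequality for the convex function \<open>t * ln t\<close>, obtained by
  averaging its tangent bound at the mean \<open>s\<close>. It gives the convexity of the divergence
  in the type of the key.\<close>

lemma mult_ln_sum_le:
  fixes w a :: "'i \<Rightarrow> real"
  assumes "finite T" "\<And>i. i \<in> T \<Longrightarrow> 0 \<le> w i" "\<And>i. i \<in> T \<Longrightarrow> 0 \<le> a i" "sum w T = 1"
  defines "s \<equiv> \<Sum>i\<in>T. w i * a i"
  shows "s * ln s \<le> (\<Sum>i\<in>T. w i * (a i * ln (a i)))"
proof (cases "s = 0")
  case True
  then have "w i * a i = 0" if "i \<in> T" for i
    using that assms by (simp add: sum_nonneg_eq_0_iff)
  then have "(\<Sum>i\<in>T. w i * (a i * ln (a i))) = 0"
    by (intro sum.neutral) (auto simp flip: mult.assoc)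
  then show ?thesis using True by simp
next
  case False
  moreover have "0 \<le> s" unfolding s_def using assms by (intro sum_nonneg) auto
  ultimately have s: "0 < s" by simp
  \<comment> \<open>The tangent to \<open>t * ln t\<close> at \<open>s\<close> is
    \<open>t * ln s + t - s\<close>; its linear part \<open>t - s\<close> averages to 0.\<close>
  have *: "a i - s \<le> a i * ln (a i) - a i * ln s" if "i \<in> T" for i
  proof (cases "a i = 0")
    case False
    then have "0 < a i" using assms(3)[OF that] by simp
    then show ?thesis using diff_le_mult_ln[of s "a i"] s by (simp add: ln_div algebra_simps)
  qed (use s in auto)
  have "0 = (\<Sum>i\<in>T. w i * (a i - s))"
    using assms(4) by (simp add: right_diff_distrib sum_subtractf s_def flip: sum_distrib_right)
  also have "\<dots> \<le> (\<Sum>i\<in>T. w i * (a i * ln (a i) - a i * ln s))"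
    using assms * by (intro sum_mono mult_left_mono) auto
  also have "\<dots> = (\<Sum>i\<in>T. w i * (a i * ln (a i))) - s * ln s"
    by (simp add: right_diff_distrib sum_subtractf s_def sum_distrib_right mult.assoc)
  finally show ?thesis by simp
qed

text \<open>Again \<open>ln t \<le> t - 1\<close>. The right-hand side is split this way because
  \<open>t\<close> will be a density with mean 1: the linear term then cancels and the chi-square
  distance remains.\<close>

lemma mult_ln_le_quadratic:
  fixes t :: real
  assumes "0 \<le> t"
  shows "t * ln t \<le> (t - 1)\<^sup>2 + (t - 1)"
proof (cases "t = 0")
  case False
  then have "t * ln t \<le> t * (t - 1)"
    using assms by (intro mult_left_mono ln_le_minus_one) auto
  then show ?thesis by (simp add: power2_eq_square algebra_simps)
qed simp

section \<open>Bounds on the mutual information\<close>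

lemma KL_divergence_measure_pmf:
  fixes A B :: "'a :: countable pmf"
  assumes "finite (set_pmf A)" "set_pmf A \<subseteq> set_pmf B"
  shows "KL_divergence 2 (measure_pmf B) (measure_pmf A) =
    (\<Sum>x\<in>set_pmf A. pmf A x * log 2 (pmf A x / pmf B x))"
proof -
  interpret sigma_finite_measure "count_space (UNIV :: 'a set)"
    by (rule sigma_finite_measure_count_space)
  have "pmf B x = 0 \<Longrightarrow> pmf A x = 0" for x
    using assms by (auto simp: set_pmf_eq)
  then have "KL_divergence 2 (density (count_space UNIV) (pmf B)) (density (count_space UNIV) (pmf A)) =
      (\<integral>x. pmf A x * log 2 (pmf A x / pmf B x) \<partial>count_space UNIV)"
    by (intro KL_density_density) auto
  also have "\<dots> = measure_pmf.expectation A (\<lambda>x. log 2 (pmf A x / pmf B x))"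
    unfolding measure_pmf_eq_density by (simp add: integral_density)
  also have "\<dots> = (\<Sum>x\<in>set_pmf A. pmf A x * log 2 (pmf A x / pmf B x))"
    using assms(1) by (subst integral_measure_pmf_real[of "set_pmf A"]) (auto simp: mult.commute)
  finally show ?thesis
    by (simp add: measure_pmf_eq_density)
qed

lemma sum_pmf_le_1:
  assumes "finite A"
  shows "sum (pmf p) A \<le> 1"
  using assms by (simp flip: measure_measure_pmf_finite)

text \<open>\<open>D\<close> is the mutual information of the two components. Replacing the true law
  of the first component by weights \<open>V\<close> adds exactly the divergence of that law from
  \<open>V\<close>, which is nonnegative. The mutual information is thus bounded through any
  convenient \<open>V\<close> of mass at most 1.\<close>

lemma KL_divergence_marginals:
  fixes J :: "('c :: countable \<times> 'x :: countable) pmf"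
  assumes fin: "finite (set_pmf J)"
  defines "D \<equiv> KL_divergence 2 (measure_pmf (pair_pmf (map_pmf fst J) (map_pmf snd J))) (measure_pmf J)"
  shows KL_divergence_marginals_nonneg: "0 \<le> D"
    and KL_divergence_marginals_le:
      "\<lbrakk>\<And>c. c \<in> fst ` set_pmf J \<Longrightarrow> 0 < V c; sum V (fst ` set_pmf J) \<le> 1\<rbrakk> \<Longrightarrow>
        D \<le> (\<Sum>z\<in>set_pmf J. pmf J z * log 2 (pmf J z / (V (fst z) * pmf (map_pmf snd J) (snd z))))"
proof -
  define C where "C = map_pmf fst J"
  define X where "X = map_pmf snd J"
  have pos: "0 < pmf J z" "0 < pmf C (fst z)" "0 < pmf X (snd z)" if "z \<in> set_pmf J" for z
    using that by (auto simp: C_def X_def pmf_positive_iff)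
  have sub: "set_pmf J \<subseteq> set_pmf (pair_pmf C X)"
    by (auto simp: C_def X_def image_iff Bex_def)
  have D: "D = (\<Sum>z\<in>set_pmf J. pmf J z * log 2 (pmf J z / (pmf C (fst z) * pmf X (snd z))))"
    unfolding D_def C_def[symmetric] X_def[symmetric] using KL_divergence_measure_pmf[OF fin sub]
    by (simp add: pmf_pair case_prod_unfold split: prod.splits) (intro sum.cong, auto simp: pmf_pair)
  have tot: "sum (pmf J) (set_pmf J) = 1"
    using fin by (simp add: sum_pmf_eq_1)
  have "(\<Sum>z\<in>set_pmf J. pmf C (fst z) * pmf X (snd z)) = sum (pmf (pair_pmf C X)) (set_pmf J)"
    by (intro sum.cong) (auto simp: pmf_pair)
  also have "\<dots> \<le> 1" by (rule sum_pmf_le_1[OF fin])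
  finally show "0 \<le> D"
    unfolding D using tot pos by (intro gibbs_inequality) auto
  assume V: "\<And>c. c \<in> fst ` set_pmf J \<Longrightarrow> 0 < V c" "sum V (fst ` set_pmf J) \<le> 1"
  have setC: "set_pmf C = fst ` set_pmf J" by (simp add: C_def)
  have finC: "finite (set_pmf C)" using fin by (simp add: C_def)
  \<comment> \<open>The divergence of the first marginal from \<open>V\<close>. Written as an
    expectation under \<open>J\<close>, it can be added to \<open>D\<close> term by term, and the
    factor \<open>pmf C\<close> cancels inside the logarithm.\<close>
  have "0 \<le> (\<Sum>c\<in>set_pmf C. pmf C c * log 2 (pmf C c / V c))"
    using V finC by (intro gibbs_inequality) (auto simp: setC sum_pmf_eq_1)
  also have "\<dots> = measure_pmf.expectation C (\<lambda>c. log 2 (pmf C c / V c))"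
    using finC by (subst integral_measure_pmf_real[of "set_pmf C"]) (auto simp: mult.commute)
  also have "\<dots> = measure_pmf.expectation J (\<lambda>z. log 2 (pmf C (fst z) / V (fst z)))"
    by (simp add: C_def)
  also have "\<dots> = (\<Sum>z\<in>set_pmf J. pmf J z * log 2 (pmf C (fst z) / V (fst z)))"
    using fin by (subst integral_measure_pmf_real[of "set_pmf J"]) (auto simp: mult.commute)
  finally have "D \<le> D + \<dots>" by simp
  also have "\<dots> = (\<Sum>z\<in>set_pmf J. pmf J z * log 2 (pmf J z / (V (fst z) * pmf X (snd z))))"
    unfolding D sum.distrib[symmetric]
  proof (intro sum.cong refl)
    fix z assume z: "z \<in> set_pmf J"
    then have "0 < V (fst z)" using V by auto
    then show "pmf J z * log 2 (pmf J z / (pmf C (fst z) * pmf X (snd z))) +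
        pmf J z * log 2 (pmf C (fst z) / V (fst z)) =
        pmf J z * log 2 (pmf J z / (V (fst z) * pmf X (snd z)))"
      using pos[OF z] by (simp add: log_divide log_mult algebra_simps)
  qed
  finally show "D \<le> (\<Sum>z\<in>set_pmf J. pmf J z * log 2 (pmf J z / (V (fst z) * pmf (map_pmf snd J) (snd z))))"
    by (simp add: X_def)
qed

lemma pmf_channel:
  fixes P :: "'k :: countable pmf" and Q :: "'x :: countable pmf"
  shows "pmf (map_pmf (\<lambda>(k, x). (\<Phi> k x, x)) (pair_pmf P Q)) (c, x) =
    pmf Q x * pmf (map_pmf (\<lambda>k. \<Phi> k x) P) c"
proof -
  have "(\<lambda>(k, x). (\<Phi> k x, x)) -` {(c, x)} = ((\<lambda>k. \<Phi> k x) -` {c}) \<times> {x}"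
    by auto
  then show ?thesis
    by (simp add: pmf_map measure_pmf_prob_product pmf.rep_eq[symmetric] measure_pmf_single mult.commute)
qed

lemma finite_set_replicate_pmf [simp]: "finite (set_pmf (replicate_pmf n (p :: 'a :: finite pmf)))"
  by (rule finite_subset[OF _ finite_lists_length_eq[of UNIV n]]) (auto simp: set_replicate_pmf)

text \<open>Averaging over the key turns the cipher into a channel \<open>W\<close> from plaintexts
  to codewords. The leakage is then at most the mean divergence of \<open>W x\<close> from a freely
  chosen reference law \<open>V\<close>, so the true law of the ciphertext never has to be
  computed.\<close>

lemma
  fixes \<Phi> :: "'a :: finite list \<Rightarrow> 'a list \<Rightarrow> bool list"
    and pX pK :: "'a pmf" and n :: nat
  defines "W \<equiv> \<lambda>x. map_pmf (\<lambda>k. \<Phi> k x) (replicate_pmf n pK)"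
    and "Q \<equiv> replicate_pmf n pX"
  shows Delta_MI_nonneg: "0 \<le> Delta_MI n \<Phi> pX pK"
    and Delta_MI_le: "\<lbrakk>finite B; \<And>x. x \<in> set_pmf Q \<Longrightarrow> set_pmf (W x) \<subseteq> B;
        \<And>c. c \<in> B \<Longrightarrow> 0 < V c; sum V B \<le> 1\<rbrakk> \<Longrightarrow>
      Delta_MI n \<Phi> pX pK \<le>
        (\<Sum>x\<in>set_pmf Q. pmf Q x * (\<Sum>c\<in>set_pmf (W x). pmf (W x) c * log 2 (pmf (W x) c / V c)))"
proof -
  define J where "J = map_pmf (\<lambda>(k, x). (\<Phi> k x, x)) (key_source n pK pX)"
  have fin: "finite (set_pmf J)"
    by (simp add: J_def key_source_def)
  have J: "pmf J (c, x) = pmf Q x * pmf (W x) c" for c x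
    unfolding J_def key_source_def Q_def W_def by (rule pmf_channel)
  have X: "map_pmf snd J = Q"
    by (simp add: J_def key_source_def map_pmf_comp case_prod_unfold map_snd_pair_pmf Q_def)
  have setJ: "set_pmf J = prod.swap ` (SIGMA x:set_pmf Q. set_pmf (W x))"
    unfolding J_def key_source_def Q_def W_def by (auto simp: image_iff)
  note eq = Delta_MI_eq_KL[of n \<Phi> pX pK, folded J_def]
  show "0 \<le> Delta_MI n \<Phi> pX pK"
    unfolding eq by (rule KL_divergence_marginals_nonneg[OF fin])
  assume B: "finite B" "\<And>x. x \<in> set_pmf Q \<Longrightarrow> set_pmf (W x) \<subseteq> B"
    and V: "\<And>c. c \<in> B \<Longrightarrow> 0 < V c" "sum V B \<le> 1"
  have sub: "fst ` set_pmf J \<subseteq> B"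
    using B(2) by (fastforce simp: setJ)
  have "sum V (fst ` set_pmf J) \<le> sum V B"
    using B sub V by (intro sum_mono2) (auto intro: less_imp_le)
  then have "Delta_MI n \<Phi> pX pK \<le>
      (\<Sum>z\<in>set_pmf J. pmf J z * log 2 (pmf J z / (V (fst z) * pmf (map_pmf snd J) (snd z))))"
    unfolding eq using V sub by (intro KL_divergence_marginals_le[OF fin]) auto
  also have "\<dots> = (\<Sum>(x, c)\<in>(SIGMA x:set_pmf Q. set_pmf (W x)).
      pmf Q x * (pmf (W x) c * log 2 (pmf (W x) c / V c)))"
    unfolding setJ X
    by (subst sum.reindex) (auto simp: J pmf_positive_iff set_pmf_iff intro!: sum.cong)
  also have "\<dots> = (\<Sum>x\<in>set_pmf Q. \<Sum>c\<in>set_pmf (W x).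
      pmf Q x * (pmf (W x) c * log 2 (pmf (W x) c / V c)))"
    by (subst sum.Sigma) (auto simp: Q_def W_def)
  finally show "Delta_MI n \<Phi> pX pK \<le>
        (\<Sum>x\<in>set_pmf Q. pmf Q x * (\<Sum>c\<in>set_pmf (W x). pmf (W x) c * log 2 (pmf (W x) c / V c)))"
    by (simp add: sum_distrib_left)
qed

section \<open>Balanced hash functions\<close>

text \<open>Take a function with \<open>h k = h k'\<close> and overwrite its value at
  \<open>k'\<close> by an arbitrary \<open>b\<close>. The pair can be recovered from the result:
  \<open>b\<close> is the new value at \<open>k'\<close>, and the old one equals the value at
  \<open>k\<close>. So the fraction of functions that collide on a given pair is at most
  \<open>1 / card B\<close>.\<close>

lemma card_PiE_collision_le:
  assumes "finite A" "finite B" "k \<in> A" "k' \<in> A" "k \<noteq> k'"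
  shows "card {h \<in> A \<rightarrow>\<^sub>E B. h k = h k'} * card B \<le> card (A \<rightarrow>\<^sub>E B)"
proof -
  have "card ({h \<in> A \<rightarrow>\<^sub>E B. h k = h k'} \<times> B) \<le> card (A \<rightarrow>\<^sub>E B)"
  proof (rule card_inj_on_le)
    show "inj_on (\<lambda>(h, b). h(k' := b)) ({h \<in> A \<rightarrow>\<^sub>E B. h k = h k'} \<times> B)"
    proof (rule inj_onI, clarsimp)
      fix h g b c
      assume eq: "h k = h k'" "g k = g k'" "h(k' := b) = g(k' := c)"
      have other: "h x = g x" if "x \<noteq> k'" for x
        using fun_cong[OF eq(3), of x] that by simp
      have "h x = g x" for x
        using other[of x] other[OF assms(5)] eq by (cases "x = k'") auto
      then show "h = g \<and> b = c"
        using fun_cong[OF eq(3), of k'] by auto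
    qed
    show "(\<lambda>(h, b). h(k' := b)) ` ({h \<in> A \<rightarrow>\<^sub>E B. h k = h k'} \<times> B) \<subseteq> A \<rightarrow>\<^sub>E B"
      using assms(4) by (auto simp: PiE_iff extensional_def)
    show "finite (A \<rightarrow>\<^sub>E B)" using assms by (intro finite_PiE) auto
  qed
  then show ?thesis by (simp add: card_cartesian_product)
qed

lemma sum_card_fibres_squared:
  assumes "finite T" "finite B" "h ` T \<subseteq> B"
  shows "(\<Sum>y\<in>B. (card {k \<in> T. h k = y})\<^sup>2) = card {p \<in> T \<times> T. h (fst p) = h (snd p)}"
proof -
  have "{p \<in> T \<times> T. h (fst p) = h (snd p)} = (\<Union>y\<in>B. {k \<in> T. h k = y} \<times> {k \<in> T. h k = y})"
    using assms(3) by auto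
  then have "card {p \<in> T \<times> T. h (fst p) = h (snd p)} =
      (\<Sum>y\<in>B. card ({k \<in> T. h k = y} \<times> {k \<in> T. h k = y}))"
    using assms(1,2) by (simp only:) (rule card_UN_disjoint, auto)
  then show ?thesis by (simp add: card_cartesian_product power2_eq_square)
qed

lemma sum_card_fibres:
  assumes "finite T" "finite B" "h ` T \<subseteq> B"
  shows "(\<Sum>y\<in>B. card {k \<in> T. h k = y}) = card T"
proof -
  have "T = (\<Union>y\<in>B. {k \<in> T. h k = y})" using assms(3) by auto
  then have "card T = card (\<Union>y\<in>B. {k \<in> T. h k = y})" by simp
  also have "\<dots> = (\<Sum>y\<in>B. card {k \<in> T. h k = y})"
    using assms(1,2) by (intro card_UN_disjoint) auto
  finally show ?thesis by simp
qed

text \<open>Multiplied by \<open>card B / (card T)^2\<close>, this is the chi-square distance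
  between the law of the hash of a key uniform on \<open>T\<close> and the uniform law on
  \<open>B\<close>.\<close>

definition fibre_deviation :: "'y set \<Rightarrow> 'k set \<Rightarrow> ('k \<Rightarrow> 'y) \<Rightarrow> real" where
  "fibre_deviation B T h = (\<Sum>y\<in>B. (real (card {k \<in> T. h k = y}) - card T / card B)\<^sup>2)"

lemma fibre_deviation_nonneg: "0 \<le> fibre_deviation B T h"
  unfolding fibre_deviation_def by (intro sum_nonneg) auto

text \<open>The usual variance formula: the fibre sizes add up to \<open>card T\<close>, and their
  squares count the ordered colliding pairs.\<close>

lemma fibre_deviation_eq:
  assumes "finite T" "finite B" "B \<noteq> {}" "h ` T \<subseteq> B"
  shows "fibre_deviation B T h =
    real (card {p \<in> T \<times> T. h (fst p) = h (snd p)}) - (card T)\<^sup>2 / card B"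
proof -
  define N where "N y = real (card {k \<in> T. h k = y})" for y
  define t where "t = real (card T)"
  define b where "b = real (card B)"
  have b: "b > 0" using assms by (simp add: b_def card_gt_0_iff)
  have N1: "(\<Sum>y\<in>B. N y) = t"
    using sum_card_fibres[OF assms(1,2,4)] by (simp add: N_def t_def flip: of_nat_sum)
  have N2: "(\<Sum>y\<in>B. (N y)\<^sup>2) = real (card {p \<in> T \<times> T. h (fst p) = h (snd p)})"
    using sum_card_fibres_squared[OF assms(1,2,4)]
    by (simp add: N_def flip: of_nat_sum of_nat_power)
  have "fibre_deviation B T h = (\<Sum>y\<in>B. (N y - t / b)\<^sup>2)"
    by (simp add: fibre_deviation_def N_def t_def b_def)
  also have "\<dots> = (\<Sum>y\<in>B. (N y)\<^sup>2 - 2 * (t / b) * N y + (t / b)\<^sup>2)"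
    by (intro sum.cong refl) (simp add: power2_diff)
  also have "\<dots> = (\<Sum>y\<in>B. (N y)\<^sup>2) - 2 * (t / b) * (\<Sum>y\<in>B. N y) + b * (t / b)\<^sup>2"
    by (simp only: sum.distrib sum_subtractf sum_distrib_left) (simp add: b_def)
  also have "\<dots> = (\<Sum>y\<in>B. (N y)\<^sup>2) - t\<^sup>2 / b"
    using b by (simp add: N1 power2_eq_square)
  finally show ?thesis by (simp add: N2 t_def b_def)
qed

text \<open>In the mean over all functions, distinct pairs collide with frequency at most
  \<open>1 / card B\<close>, which is compensated by the subtracted term of
  \<open>fibre_deviation_eq\<close>. Only the \<open>card T\<close> diagonal pairs, which always
  collide, are left.\<close>

lemma sum_fibre_deviation_le:
  assumes "finite A" "finite B" "B \<noteq> {}" "T \<subseteq> A"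
  shows "(\<Sum>h\<in>A \<rightarrow>\<^sub>E B. fibre_deviation B T h) \<le> real (card (A \<rightarrow>\<^sub>E B)) * card T"
proof -
  let ?F = "A \<rightarrow>\<^sub>E B"
  define t where "t = real (card T)"
  define b where "b = real (card B)"
  define f where "f = real (card ?F)"
  have b: "b \<ge> 1" using assms by (simp add: b_def card_gt_0_iff Suc_le_eq)
  have finT: "finite T" using assms finite_subset by auto
  have finF: "finite ?F" using assms by (intro finite_PiE) auto
  have im: "h ` T \<subseteq> B" if "h \<in> ?F" for h using that assms(4) by auto
  have "real (\<Sum>h\<in>?F. card {p \<in> T \<times> T. h (fst p) = h (snd p)}) =
      real (\<Sum>p\<in>T \<times> T. card {h \<in> ?F. h (fst p) = h (snd p)})"
    using sum_multicount_gen[of ?F "T \<times> T" "\<lambda>h p. h (fst p) = h (snd p)"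
      "\<lambda>p. card {h \<in> ?F. h (fst p) = h (snd p)}"] finF finT by simp
  also have "\<dots> = (\<Sum>p\<in>T \<times> T. real (card {h \<in> ?F. h (fst p) = h (snd p)}))"
    by simp
  \<comment> \<open>The share \<open>f / b\<close> is charged to diagonal pairs as well, so that
    these shares sum to exactly the amount subtracted later.\<close>
  also have "\<dots> \<le> (\<Sum>p\<in>T \<times> T. f / b + (if fst p = snd p then f else 0))"
  proof (intro sum_mono)
    fix p assume p: "p \<in> T \<times> T"
    show "real (card {h \<in> ?F. h (fst p) = h (snd p)}) \<le> f / b + (if fst p = snd p then f else 0)"
    proof (cases "fst p = snd p")
      case False
      have "real (card {h \<in> ?F. h (fst p) = h (snd p)} * card B) \<le> f"
        unfolding f_def using p False assms by (intro of_nat_mono card_PiE_collision_le) auto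
      then show ?thesis using False b by (simp add: field_simps b_def)
    qed (use b in \<open>auto simp: f_def\<close>)
  qed
  also have "\<dots> = t\<^sup>2 * (f / b) + (\<Sum>p\<in>T \<times> T. if fst p = snd p then f else 0)"
    by (simp add: sum.distrib card_cartesian_product t_def power2_eq_square)
  also have "(\<Sum>p\<in>T \<times> T. if fst p = snd p then f else 0) = (\<Sum>x\<in>T. \<Sum>y\<in>T. if x = y then f else 0)"
    by (simp add: sum.cartesian_product case_prod_unfold)
  also have "\<dots> = t * f"
    using finT by (simp add: sum.delta t_def)
  finally have *: "(\<Sum>h\<in>?F. real (card {p \<in> T \<times> T. h (fst p) = h (snd p)})) \<le> t\<^sup>2 * (f / b) + t * f"
    by simp
  have "(\<Sum>h\<in>?F. fibre_deviation B T h) =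
      (\<Sum>h\<in>?F. real (card {p \<in> T \<times> T. h (fst p) = h (snd p)}) - t\<^sup>2 / b)"
    using assms finT im by (intro sum.cong refl) (simp add: fibre_deviation_eq t_def b_def)
  also have "\<dots> = (\<Sum>h\<in>?F. real (card {p \<in> T \<times> T. h (fst p) = h (snd p)})) - f * (t\<^sup>2 / b)"
    by (simp add: sum_subtractf f_def)
  also have "\<dots> \<le> t * f" using * by (simp add: mult.commute)
  finally show ?thesis by (simp add: t_def f_def mult.commute)
qed

text \<open>First-moment argument. Normalised by \<open>card (T i)\<close>, each deviation has mean
  at most 1 over all functions, so some \<open>h\<close> keeps the sum over all \<open>i\<close>
  below \<open>card I\<close>. The terms are nonnegative, hence each of them obeys the same bound
  for this single \<open>h\<close>.\<close>

lemma exists_balanced_hash: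
  fixes T :: "'i \<Rightarrow> 'k set" and B :: "'y set"
  assumes "finite A" "finite B" "B \<noteq> {}" "finite I" "\<And>i. i \<in> I \<Longrightarrow> T i \<subseteq> A"
  obtains h where "h ` A \<subseteq> B"
    "\<And>i. i \<in> I \<Longrightarrow> fibre_deviation B (T i) h \<le> real (card I) * card (T i)"
proof -
  let ?F = "A \<rightarrow>\<^sub>E B"
  define I' where "I' = {i \<in> I. T i \<noteq> {}}"
  define G where "G h = (\<Sum>i\<in>I'. fibre_deviation B (T i) h / card (T i))" for h
  have finF: "finite ?F" using assms by (intro finite_PiE) auto
  have finT: "finite (T i)" if "i \<in> I" for i using that assms finite_subset by blast
  have F: "?F \<noteq> {}" using assms by (simp add: PiE_eq_empty_iff)
  have "(\<Sum>h\<in>?F. G h) = (\<Sum>i\<in>I'. (\<Sum>h\<in>?F. fibre_deviation B (T i) h) / card (T i))"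
    unfolding G_def by (subst sum.swap) (simp add: sum_divide_distrib)
  also have "\<dots> \<le> (\<Sum>i\<in>I'. real (card ?F))"
  proof (intro sum_mono)
    fix i assume i: "i \<in> I'"
    then have "card (T i) > 0" using finT by (auto simp: I'_def card_gt_0_iff)
    then show "(\<Sum>h\<in>?F. fibre_deviation B (T i) h) / card (T i) \<le> real (card ?F)"
      using sum_fibre_deviation_le[of A B "T i"] assms i by (simp add: I'_def divide_le_eq)
  qed
  also have "\<dots> \<le> (\<Sum>h\<in>?F. real (card I))"
    using assms card_mono[of I I']
    by (simp add: I'_def mult.commute[of _ "real (card ?F)"] mult_left_mono)
  finally have "\<exists>h\<in>?F. G h \<le> card I"
    using sum_strict_mono[of ?F "\<lambda>_. real (card I)" G] finF F by (meson linorder_not_less)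
  then obtain h where h: "h \<in> ?F" "G h \<le> card I" by blast
  show ?thesis
  proof (rule that[of h])
    show "h ` A \<subseteq> B" using h by auto
    fix i assume i: "i \<in> I"
    show "fibre_deviation B (T i) h \<le> real (card I) * card (T i)"
    proof (cases "T i = {}")
      case True
      then show ?thesis by (simp add: fibre_deviation_def)
    next
      case False
      then have pos: "card (T i) > 0" using finT i by (simp add: card_gt_0_iff)
      have "fibre_deviation B (T i) h / card (T i) \<le> G h"
        unfolding G_def using False i assms(4)
        by (intro member_le_sum[where f = "\<lambda>i. fibre_deviation B (T i) h / card (T i)"])
          (auto simp: I'_def fibre_deviation_nonneg)
      then have "fibre_deviation B (T i) h / card (T i) \<le> card I" using h by simp
      then show ?thesis using pos by (simp add: divide_le_eq)
    qed
  qed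
qed

section \<open>Types\<close>

lemma pmf_replicate_pmf:
  "pmf (replicate_pmf n p) xs = (if length xs = n then \<Prod>x\<leftarrow>xs. pmf p x else 0)"
proof (induction n arbitrary: xs)
  case 0
  show ?case by (cases xs) auto
next
  case (Suc n)
  have eq: "replicate_pmf (Suc n) p = map_pmf (\<lambda>(x, xs). x # xs) (pair_pmf p (replicate_pmf n p))"
    by (simp add: pair_pmf_def map_bind_pmf map_pmf_def bind_assoc_pmf bind_return_pmf)
  show ?case
  proof (cases xs)
    case Nil
    then show ?thesis by (auto simp: pmf_eq_0_set_pmf set_replicate_pmf)
  next
    case (Cons y ys)
    have "pmf (map_pmf (\<lambda>(x, xs). x # xs) (pair_pmf p (replicate_pmf n p))) ((\<lambda>(x, xs). x # xs) (y, ys)) =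
        pmf (pair_pmf p (replicate_pmf n p)) (y, ys)"
      by (intro pmf_map_inj') (auto simp: inj_def)
    then show ?thesis using Suc Cons eq by (simp add: pmf_pair)
  qed
qed

lemma prod_list_eq_prod_count:
  fixes f :: "'a :: finite \<Rightarrow> 'b :: comm_monoid_mult"
  shows "(\<Prod>x\<leftarrow>xs. f x) = (\<Prod>a\<in>UNIV. f a ^ count (mset xs) a)"
proof (induction xs)
  case (Cons x xs)
  have "(\<Prod>a\<in>UNIV. f a ^ count (mset (x # xs)) a) =
      (\<Prod>a\<in>UNIV. f a ^ count (mset xs) a * (if a = x then f a else 1))"
    by (intro prod.cong) (auto simp: mult.commute)
  then show ?case using Cons by (simp add: prod.distrib prod.delta mult.commute)
qed simp

text \<open>The type (empirical distribution) of a sequence is encoded by its multiset of letters.\<close>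

lemma pmf_replicate_pmf_type:
  fixes Q :: "'a :: finite pmf" and M :: "'a multiset"
  assumes "mset xs = M" "M \<noteq> {#}" "set_mset M \<subseteq> set_pmf Q"
  defines "P \<equiv> pmf_of_multiset M"
  shows "pmf (replicate_pmf (size M) Q) xs =
    2 powr (- real (size M) * (shannon_entropy P + real_of_ereal (rel_entropy P Q)))"
proof -
  have P: "pmf P a = count M a / size M" for a
    using assms(2) by (simp add: P_def)
  have sz: "real (size M) > 0" using assms(2) by (simp add: nonempty_has_size)
  have Q: "pmf Q a > 0" if "a \<in># M" for a
    using that assms(3) by (auto simp: pmf_positive_iff)
  have sub: "set_pmf P \<subseteq> set_pmf Q" using assms(2,3) by (simp add: P_def)
  have len: "length xs = size M" using assms(1) by auto
  have "pmf (replicate_pmf (size M) Q) xs = (\<Prod>a\<in>UNIV. pmf Q a ^ count M a)"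
    using len by (simp add: pmf_replicate_pmf prod_list_eq_prod_count assms(1))
  also have "\<dots> = (\<Prod>a\<in>UNIV. 2 powr (count M a * log 2 (pmf Q a)))"
  proof (intro prod.cong refl)
    fix a
    show "pmf Q a ^ count M a = 2 powr (count M a * log 2 (pmf Q a))"
    proof (cases "a \<in># M")
      case True
      have "2 powr (count M a * log 2 (pmf Q a)) = (2 powr log 2 (pmf Q a)) powr count M a"
        by (simp add: powr_powr mult.commute)
      also have "\<dots> = pmf Q a ^ count M a" using Q[OF True] by (simp add: powr_realpow)
      finally show ?thesis by simp
    qed (simp add: not_in_iff)
  qed
  also have "\<dots> = 2 powr (\<Sum>a\<in>UNIV. count M a * log 2 (pmf Q a))"
    by (simp add: powr_sum)
  \<comment> \<open>The exponent is the negative of \<open>size M\<close> times the cross entropy of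
    \<open>P\<close> and \<open>Q\<close>, and the cross entropy splits into entropy plus
    divergence.\<close>
  also have "(\<Sum>a\<in>UNIV. count M a * log 2 (pmf Q a)) =
      - real (size M) * (shannon_entropy P + real_of_ereal (rel_entropy P Q))"
  proof -
    have "shannon_entropy P + real_of_ereal (rel_entropy P Q) =
        (\<Sum>a\<in>UNIV. pmf P a * log 2 (pmf P a / pmf Q a) - pmf P a * log 2 (pmf P a))"
      using sub by (simp add: shannon_entropy_eq_sum rel_entropy_eq_sum sum_subtractf)
    also have "\<dots> = (\<Sum>a\<in>UNIV. - (count M a / size M * log 2 (pmf Q a)))"
    proof (intro sum.cong refl)
      fix a
      show "pmf P a * log 2 (pmf P a / pmf Q a) - pmf P a * log 2 (pmf P a) =
          - (count M a / size M * log 2 (pmf Q a))"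
      proof (cases "a \<in># M")
        case True
        then have "pmf P a > 0" using P sz by simp
        then show ?thesis using Q[OF True] by (simp add: log_divide algebra_simps P[symmetric])
      qed (simp add: P not_in_iff)
    qed
    finally show ?thesis using sz assms(2) by (simp add: sum_negf sum_distrib_left field_simps)
  qed
  finally show ?thesis .
qed

lemma rel_entropy_same: "rel_entropy P P = 0"
  by (simp add: rel_entropy_def sigma_finite_measure.KL_same_eq_0
    prob_space_imp_sigma_finite prob_space_measure_pmf)

lemma finite_mset_eq [simp]: "finite {xs. mset xs = M}"
  by (rule finite_subset[OF _ finite_lists_length_eq[OF finite_set_mset[of M], of "size M"]]) auto

text \<open>Under the empirical law of the class itself the divergence vanishes, so every member has
  probability \<open>2 powr (- n * H)\<close> with \<open>n\<close> the size of \<open>M\<close> and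
  \<open>H\<close> the entropy of its type. These probabilities add up to at most 1.\<close>

lemma card_type_class_le:
  fixes M :: "'a :: finite multiset"
  assumes "M \<noteq> {#}"
  shows "real (card {xs. mset xs = M}) \<le> 2 powr (size M * shannon_entropy (pmf_of_multiset M))"
proof -
  let ?P = "pmf_of_multiset M"
  have "card {xs. mset xs = M} * 2 powr (- real (size M) * shannon_entropy ?P) =
      sum (pmf (replicate_pmf (size M) ?P)) {xs. mset xs = M}"
    using assms by (subst sum.cong[OF refl pmf_replicate_pmf_type]) (auto simp: rel_entropy_same)
  also have "\<dots> \<le> 1" by (rule sum_pmf_le_1) simp
  finally show ?thesis by (simp add: powr_minus field_simps)
qed

text \<open>The two cases are separated because \<open>real_of_ereal\<close> sends an infinite
  divergence to 0. In the second case the class contains a letter that \<open>Q\<close> never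
  emits.\<close>

lemma
  fixes Q :: "'a :: finite pmf" and M :: "'a multiset"
  assumes "M \<noteq> {#}"
  defines "P \<equiv> pmf_of_multiset M"
  shows prob_type_class: "set_mset M \<subseteq> set_pmf Q \<Longrightarrow>
      measure_pmf.prob (replicate_pmf (size M) Q) {xs. mset xs = M} = card {xs. mset xs = M} *
        2 powr (- real (size M) * (shannon_entropy P + real_of_ereal (rel_entropy P Q)))"
    and prob_type_class_eq_0: "\<not> set_mset M \<subseteq> set_pmf Q \<Longrightarrow>
      measure_pmf.prob (replicate_pmf (size M) Q) {xs. mset xs = M} = 0"
proof -
  assume "set_mset M \<subseteq> set_pmf Q"
  then show "measure_pmf.prob (replicate_pmf (size M) Q) {xs. mset xs = M} = card {xs. mset xs = M} *
        2 powr (- real (size M) * (shannon_entropy P + real_of_ereal (rel_entropy P Q)))"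
    unfolding P_def using assms
    by (subst measure_measure_pmf_finite, simp)
      (subst sum.cong[OF refl pmf_replicate_pmf_type], auto)
next
  assume "\<not> set_mset M \<subseteq> set_pmf Q"
  then have "set_pmf (replicate_pmf (size M) Q) \<inter> {xs. mset xs = M} = {}"
    by (auto simp: set_replicate_pmf)
  then show "measure_pmf.prob (replicate_pmf (size M) Q) {xs. mset xs = M} = 0"
    by (simp add: measure_pmf_zero_iff)
qed

text \<open>A multiset is determined by its counts, each between 0 and \<open>n\<close>. This is the
  polynomial bound on the number of types.\<close>

lemma
  shows finite_multisets_of_size_UNIV: "finite {M :: 'a :: finite multiset. size M = n}"
    and card_multisets_of_size_UNIV_le:
      "card {M :: 'a multiset. size M = n} \<le> (n + 1) ^ CARD('a)"
proof -
  have inj: "inj_on count {M :: 'a multiset. size M = n}"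
    by (auto intro!: inj_onI simp: multiset_eq_iff)
  have sub: "count ` {M :: 'a multiset. size M = n} \<subseteq> (UNIV :: 'a set) \<rightarrow>\<^sub>E {..n}"
    by (auto intro: order.trans[OF count_le_size])
  have fin: "finite ((UNIV :: 'a set) \<rightarrow>\<^sub>E {..n})" by (intro finite_PiE) auto
  show "finite {M :: 'a multiset. size M = n}"
    using inj sub fin by (rule inj_on_finite)
  show "card {M :: 'a multiset. size M = n} \<le> (n + 1) ^ CARD('a)"
    using card_inj_on_le[OF inj sub fin] by (simp add: card_PiE)
qed

section \<open>Positivity of the exponents\<close>

lemma continuous_on_mult_log: "continuous_on {0..} (\<lambda>t::real. t * log 2 t)"
proof -
  have "((\<lambda>t::real. t * log 2 t) \<longlongrightarrow> 0) (at_right 0)"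
    by real_asymp
  moreover have "at (0::real) within {0..} = at_right 0"
  proof -
    have "{0..} - {0} = {0<..} - {0::real}" by auto
    then show ?thesis by (simp only: at_within_def)
  qed
  ultimately have "continuous (at (0::real) within {0..}) (\<lambda>t::real. t * log 2 t)"
    by (simp add: continuous_within)
  moreover have "continuous (at t within {0..}) (\<lambda>t::real. t * log 2 t)" if "0 < t" for t :: real
    unfolding continuous_within
    by (rule tendsto_mult[OF tendsto_ident_at tendsto_log[OF tendsto_const tendsto_ident_at]])
      (use that in simp_all)
  ultimately show ?thesis
    unfolding continuous_on_eq_continuous_within by (metis atLeast_iff order_le_less)
qed

text \<open>The relative entropy dominates the squared Hellinger distance, since
  \<open>ln (q / p) \<le> 2 (sqrt (q / p) - 1)\<close>.\<close>

lemma hellinger_le_rel_entropy: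
  fixes P Q :: "'a :: finite pmf"
  shows "ereal (\<Sum>x\<in>UNIV. (sqrt (pmf P x) - sqrt (pmf Q x))\<^sup>2) \<le> rel_entropy P Q"
proof (cases "set_pmf P \<subseteq> set_pmf Q")
  case True
  have le: "2 * (pmf P x - sqrt (pmf P x) * sqrt (pmf Q x)) \<le> pmf P x * log 2 (pmf P x / pmf Q x) * ln 2" for x
  proof (cases "x \<in> set_pmf P")
    case p: True
    define p q where "p = sqrt (pmf P x)" and "q = sqrt (pmf Q x)"
    have pq: "0 < p" "0 < q" "pmf P x = p\<^sup>2" "pmf Q x = q\<^sup>2"
      using p True by (auto simp: p_def q_def pmf_positive_iff)
    \<comment> \<open>The logarithmic bound is applied to the square roots; the factor 2 comes back
      from \<open>ln\<close> of the squares.\<close>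
    have "p - q \<le> p * ln (p / q)" using pq by (intro diff_le_mult_ln) auto
    then have "2 * p * (p - q) \<le> 2 * p * (p * ln (p / q))"
      using pq by (intro mult_left_mono) auto
    also have "\<dots> = p\<^sup>2 * ln (p\<^sup>2 / q\<^sup>2)"
    proof -
      have "ln (p\<^sup>2 / q\<^sup>2) = 2 * ln (p / q)"
        using pq by (simp add: ln_realpow flip: power_divide)
      then show ?thesis by (simp add: power2_eq_square)
    qed
    finally show ?thesis using pq
      by (simp add: p_def[symmetric] q_def[symmetric] log_def power2_eq_square algebra_simps)
  qed (simp add: set_pmf_iff)
  have ln2: "ln 2 \<le> (1::real)" using ln_2_less_1 by simp
  have "(\<Sum>x\<in>UNIV. (sqrt (pmf P x) - sqrt (pmf Q x))\<^sup>2) =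
      (\<Sum>x\<in>UNIV. pmf P x + pmf Q x - 2 * (sqrt (pmf P x) * sqrt (pmf Q x)))"
    by (intro sum.cong refl) (simp add: power2_diff)
  also have "\<dots> = (\<Sum>x\<in>UNIV. 2 * (pmf P x - sqrt (pmf P x) * sqrt (pmf Q x)))"
    by (simp add: sum.distrib sum_subtractf sum_pmf_eq_1 flip: sum_distrib_left)
  also have "\<dots> \<le> (\<Sum>x\<in>UNIV. pmf P x * log 2 (pmf P x / pmf Q x) * ln 2)"
    using le by (intro sum_mono)
  also have "\<dots> = (\<Sum>x\<in>UNIV. pmf P x * log 2 (pmf P x / pmf Q x)) * ln 2"
    by (simp add: sum_distrib_right)
  also have "\<dots> \<le> (\<Sum>x\<in>UNIV. pmf P x * log 2 (pmf P x / pmf Q x)) * 1"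
  proof (intro mult_left_mono ln2)
    have "(\<Sum>x\<in>UNIV. pmf P x * log 2 (pmf P x / pmf Q x)) =
        (\<Sum>x\<in>set_pmf P. pmf P x * log 2 (pmf P x / pmf Q x))"
      by (intro sum.mono_neutral_right) (auto simp: pmf_eq_0_set_pmf)
    also have "\<dots> \<ge> 0"
      using True by (intro gibbs_inequality) (auto simp: pmf_positive_iff sum_pmf_eq_1 sum_pmf_le_1)
    finally show "0 \<le> (\<Sum>x\<in>UNIV. pmf P x * log 2 (pmf P x / pmf Q x))" .
  qed
  finally show ?thesis using True by (simp add: rel_entropy_eq_sum)
qed (simp add: rel_entropy_def)

lemma rel_entropy_nonneg:
  fixes P Q :: "'a :: finite pmf"
  shows "0 \<le> rel_entropy P Q"
  by (rule order.trans[OF _ hellinger_le_rel_entropy]) (auto intro: sum_nonneg)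

text \<open>Vanishing divergence forces vanishing Hellinger distance, hence pointwise convergence of
  the probabilities; the entropy is continuous in these, also at probability 0.\<close>

lemma shannon_entropy_tendsto:
  fixes P :: "nat \<Rightarrow> 'a :: finite pmf"
  assumes "e \<longlonglongrightarrow> 0" "\<And>k. rel_entropy (P k) Q \<le> ereal (e k)"
  shows "(\<lambda>k. shannon_entropy (P k)) \<longlonglongrightarrow> shannon_entropy Q"
proof -
  have pmf: "(\<lambda>k. pmf (P k) x) \<longlonglongrightarrow> pmf Q x" for x
  proof -
    have "(sqrt (pmf (P k) x) - sqrt (pmf Q x))\<^sup>2 \<le> e k" for k
    proof -
      have "(sqrt (pmf (P k) x) - sqrt (pmf Q x))\<^sup>2 \<le> (\<Sum>x\<in>UNIV. (sqrt (pmf (P k) x) - sqrt (pmf Q x))\<^sup>2)"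
        by (rule member_le_sum) auto
      also have "ereal \<dots> \<le> ereal (e k)"
        using hellinger_le_rel_entropy assms(2) by (rule order.trans)
      finally show ?thesis by simp
    qed
    then have "(\<lambda>k. (sqrt (pmf (P k) x) - sqrt (pmf Q x))\<^sup>2) \<longlonglongrightarrow> 0"
      by (intro tendsto_sandwich[OF _ _ tendsto_const assms(1)]) auto
    then have "(\<lambda>k. sqrt ((sqrt (pmf (P k) x) - sqrt (pmf Q x))\<^sup>2)) \<longlonglongrightarrow> sqrt 0"
      by (rule tendsto_real_sqrt)
    then have "(\<lambda>k. sqrt (pmf (P k) x) - sqrt (pmf Q x)) \<longlonglongrightarrow> 0"
      by (simp add: tendsto_rabs_zero_iff)
    then have "(\<lambda>k. sqrt (pmf (P k) x)) \<longlonglongrightarrow> sqrt (pmf Q x)"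
      by (rule LIM_zero_cancel)
    then have "(\<lambda>k. (sqrt (pmf (P k) x))\<^sup>2) \<longlonglongrightarrow> (sqrt (pmf Q x))\<^sup>2"
      by (rule tendsto_power)
    then show ?thesis by simp
  qed
  have "(\<lambda>k. pmf (P k) x * log 2 (pmf (P k) x)) \<longlonglongrightarrow> pmf Q x * log 2 (pmf Q x)" for x
    by (rule continuous_on_tendsto_compose[OF continuous_on_mult_log pmf]) auto
  then show ?thesis
    unfolding shannon_entropy_eq_sum by (intro tendsto_minus tendsto_sum)
qed

text \<open>If the infimum were 0, feasible laws with divergence below \<open>1 / (k + 1)\<close>
  would exist. Their entropies are at least \<open>R\<close> and converge to that of
  \<open>pX\<close>, a contradiction.\<close>

lemma exponent_E_pos:
  fixes pX :: "'a :: finite pmf"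
  assumes "shannon_entropy pX < R"
  shows "0 < exponent_E R pX"
proof (rule ccontr)
  have pos: "0 < ereal (1 / real (Suc k))" for k
    by simp
  assume "\<not> 0 < exponent_E R pX"
  then have "exponent_E R pX < ereal (1 / real (Suc k))" for k
    by (rule order.strict_trans1[OF leI pos])
  then have "\<exists>P. R \<le> shannon_entropy P \<and> rel_entropy P pX < ereal (1 / real (Suc k))" for k
    unfolding exponent_E_def INF_less_iff by simp
  then have "\<exists>P. \<forall>k. R \<le> shannon_entropy (P k) \<and> rel_entropy (P k) pX < ereal (1 / real (Suc k))"
    by (intro choice allI)
  then obtain P where P: "\<And>k. R \<le> shannon_entropy (P k)"
      "\<And>k. rel_entropy (P k) pX < ereal (1 / real (Suc k))"
    by blast
  have "(\<lambda>k. shannon_entropy (P k)) \<longlonglongrightarrow> shannon_entropy pX"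
    by (intro shannon_entropy_tendsto[of "\<lambda>k. 1 / real (Suc k)"]
        LIMSEQ_inverse_real_of_nat[unfolded inverse_eq_divide] less_imp_le P(2))
  then have "R \<le> shannon_entropy pX"
    by (rule LIMSEQ_le_const) (use P(1) in blast)
  then show False using assms by simp
qed

text \<open>Along a sequence with objective tending to 0 both summands tend to 0. The divergence
  makes the entropies converge to that of \<open>pK\<close>, while the positive part pushes their
  limit down to \<open>R\<close> or below.\<close>

lemma exponent_F_pos:
  fixes pK :: "'a :: finite pmf"
  assumes "R < shannon_entropy pK"
  shows "0 < exponent_F R pK"
proof (rule ccontr)
  have pos: "0 < ereal (1 / real (Suc k))" for k
    by simp
  assume "\<not> 0 < exponent_F R pK"
  then have "exponent_F R pK < ereal (1 / real (Suc k))" for k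
    by (rule order.strict_trans1[OF leI pos])
  then have "\<exists>P. ereal (max 0 (shannon_entropy P - R)) + rel_entropy P pK < ereal (1 / real (Suc k))" for k
    unfolding exponent_F_def INF_less_iff by simp
  then have "\<exists>P. \<forall>k. ereal (max 0 (shannon_entropy (P k) - R)) + rel_entropy (P k) pK < ereal (1 / real (Suc k))"
    by (intro choice allI)
  then obtain P where P:
      "\<And>k. ereal (max 0 (shannon_entropy (P k) - R)) + rel_entropy (P k) pK < ereal (1 / real (Suc k))"
    by blast
  have P1: "rel_entropy (P k) pK \<le> ereal (1 / real (Suc k))" for k
    by (intro order.trans[OF _ less_imp_le[OF P[of k]]] add_increasing) (simp_all add: le_max_iff_disj)
  have "ereal (max 0 (shannon_entropy (P k) - R)) \<le> ereal (1 / real (Suc k))" for k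
    by (intro order.trans[OF _ less_imp_le[OF P[of k]]] add_increasing2 rel_entropy_nonneg) simp
  then have P2: "shannon_entropy (P k) \<le> R + 1 / real (Suc k)" for k
    by (simp add: algebra_simps del: of_nat_Suc)
  have lim: "(\<lambda>k. 1 / real (Suc k)) \<longlonglongrightarrow> 0"
    by (rule LIMSEQ_inverse_real_of_nat[unfolded inverse_eq_divide])
  have "(\<lambda>k. shannon_entropy (P k)) \<longlonglongrightarrow> shannon_entropy pK"
    using P1 by (intro shannon_entropy_tendsto[OF lim])
  moreover have "(\<lambda>k. R + 1 / real (Suc k)) \<longlonglongrightarrow> R + 0"
    by (intro tendsto_intros lim)
  ultimately have "shannon_entropy pK \<le> R + 0"
    by (rule LIMSEQ_le) (use P2 in blast)
  then show False using assms by simp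
qed

section \<open>Low-entropy sequences and hashed keys\<close>

text \<open>The inequality is strict so that the types of the remaining sequences of length
  \<open>n\<close> are feasible in \<open>exponent_E\<close>, where the constraint reads
  \<open>R \<le> shannon_entropy P\<close>.\<close>

definition low_entropy :: "nat \<Rightarrow> real \<Rightarrow> 'a :: finite list set" where
  "low_entropy n R = {x. length x = n \<and> shannon_entropy (pmf_of_multiset (mset x)) < R}"

lemma finite_lists_of_length [simp]: "finite {xs :: 'a :: finite list. length xs = n}"
  using finite_lists_length_eq[of "UNIV :: 'a set" n] by simp

lemma card_lists_of_length: "card {xs :: 'a :: finite list. length xs = n} = CARD('a) ^ n"
  using card_lists_length_eq[of "UNIV :: 'a set" n] by simp

text \<open>A polynomial number of type classes, each with at most \<open>2 powr (n * R)\<close>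
  members.\<close>

lemma card_low_entropy_le:
  assumes "0 < n"
  shows "real (card (low_entropy n R :: 'a :: finite list set)) \<le> real (n + 1) ^ CARD('a) * 2 powr (n * R)"
proof -
  let ?I = "{M :: 'a multiset. size M = n}"
  let ?J = "{M \<in> ?I. shannon_entropy (pmf_of_multiset M) < R}"
  have fin: "finite ?I" by (rule finite_multisets_of_size_UNIV)
  have "low_entropy n R = (\<Union>M\<in>?J. {xs :: 'a list. mset xs = M})"
    by (auto simp: low_entropy_def)
  then have "real (card (low_entropy n R :: 'a list set)) \<le> real (\<Sum>M\<in>?J. card {xs :: 'a list. mset xs = M})"
    using fin by (simp only: of_nat_le_iff) (rule card_UN_le, simp)
  also have "\<dots> \<le> (\<Sum>M\<in>?J. 2 powr (n * R))"
    unfolding of_nat_sum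
  proof (intro sum_mono)
    fix M assume M: "M \<in> ?J"
    then have "M \<noteq> {#}" using assms by auto
    then have "real (card {xs. mset xs = M}) \<le> 2 powr (size M * shannon_entropy (pmf_of_multiset M))"
      by (rule card_type_class_le)
    also have "\<dots> \<le> 2 powr (n * R)" using M by (auto intro: mult_left_mono)
    finally show "real (card {xs. mset xs = M}) \<le> 2 powr (n * R)" .
  qed
  also have "\<dots> \<le> real (card ?I) * 2 powr (n * R)"
  proof -
    have "card ?J \<le> card ?I" using fin by (intro card_mono) auto
    then show ?thesis by (simp add: mult_right_mono)
  qed
  also have "\<dots> \<le> real ((n + 1) ^ CARD('a)) * 2 powr (n * R)"
    using card_multisets_of_size_UNIV_le[where 'a = 'a] by (intro mult_right_mono of_nat_mono) auto
  finally show ?thesis by (simp add: of_nat_power)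
qed

lemma card_low_entropy_le_2_pow:
  assumes "0 < n" "n * R + CARD('a) * log 2 (n + 1) \<le> real m"
  shows "card (low_entropy n R :: 'a :: finite list set) \<le> 2 ^ m"
proof -
  have "real (card (low_entropy n R :: 'a list set)) \<le> real (n + 1) ^ CARD('a) * 2 powr (n * R)"
    using assms(1) by (rule card_low_entropy_le)
  also have "\<dots> = 2 powr (n * R + CARD('a) * log 2 (n + 1))"
  proof -
    have "2 powr (CARD('a) * log 2 (n + 1)) = (2 powr log 2 (n + 1)) powr CARD('a)"
      by (simp only: powr_powr mult.commute)
    also have "\<dots> = real (n + 1) ^ CARD('a)"
      by (simp add: powr_realpow)
    finally show ?thesis by (simp add: powr_add)
  qed
  also have "\<dots> \<le> 2 powr m" using assms(2) by (simp add: add.commute)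
  finally have "real (card (low_entropy n R :: 'a list set)) \<le> real (2 ^ m)"
    by (simp add: powr_realpow)
  then show ?thesis by (simp only: of_nat_le_iff)
qed

text \<open>The size of the class contributes at most \<open>2 powr (n * H)\<close>, which cancels
  the entropy part of the probability of each member and leaves the divergence.\<close>

lemma prob_type_class_le:
  fixes M :: "'a :: finite multiset"
  assumes "M \<noteq> {#}" "set_mset M \<subseteq> set_pmf Q" "ereal \<mu> \<le> rel_entropy (pmf_of_multiset M) Q"
  shows "measure_pmf.prob (replicate_pmf (size M) Q) {xs. mset xs = M} \<le> 2 powr (- real (size M) * \<mu>)"
proof -
  let ?P = "pmf_of_multiset M"
  define d where "d = real_of_ereal (rel_entropy ?P Q)"
  have "rel_entropy ?P Q = ereal d"
    using assms(1,2) by (simp add: d_def rel_entropy_eq_sum)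
  then have "\<mu> \<le> d" using assms(3) by simp
  have "measure_pmf.prob (replicate_pmf (size M) Q) {xs. mset xs = M} =
      card {xs. mset xs = M} * 2 powr (- real (size M) * (shannon_entropy ?P + d))"
    using assms(1,2) unfolding d_def by (rule prob_type_class)
  also have "\<dots> \<le> 2 powr (size M * shannon_entropy ?P) * 2 powr (- real (size M) * (shannon_entropy ?P + d))"
    using assms(1) by (intro mult_right_mono card_type_class_le) auto
  also have "\<dots> = 2 powr (- real (size M) * d)"
    by (simp add: algebra_simps flip: powr_add)
  also have "\<dots> \<le> 2 powr (- real (size M) * \<mu>)"
    using \<open>\<mu> \<le> d\<close> by (simp add: mult_left_mono)
  finally show ?thesis .
qed

text \<open>Union bound over the types feasible in \<open>exponent_E\<close>. A real \<mu> below the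
  exponent is used because the exponent is infinite when no law has entropy \<open>R\<close> or
  more.\<close>

lemma prob_not_low_entropy_le:
  fixes pX :: "'a :: finite pmf"
  assumes "0 < n" "ereal \<mu> \<le> exponent_E R pX"
  shows "measure_pmf.prob (replicate_pmf n pX) (- low_entropy n R) \<le>
    real (n + 1) ^ CARD('a) * 2 powr (- real n * \<mu>)"
proof -
  let ?I = "{M :: 'a multiset. size M = n}"
  let ?Q = "replicate_pmf n pX"
  let ?J = "{M \<in> ?I. R \<le> shannon_entropy (pmf_of_multiset M)}"
  have fin: "finite ?I" by (rule finite_multisets_of_size_UNIV)
  have "set_pmf ?Q \<inter> - low_entropy n R \<subseteq> (\<Union>M\<in>?J. {xs. mset xs = M})"
    by (auto simp: low_entropy_def set_replicate_pmf)
  then have "measure_pmf.prob ?Q (- low_entropy n R) \<le> measure_pmf.prob ?Q (\<Union>M\<in>?J. {xs. mset xs = M})"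
    by (subst measure_Int_set_pmf[symmetric]) (auto intro!: measure_pmf.finite_measure_mono)
  also have "\<dots> \<le> (\<Sum>M\<in>?J. measure_pmf.prob ?Q {xs. mset xs = M})"
    using fin by (intro measure_pmf.finite_measure_subadditive_finite) auto
  also have "\<dots> \<le> (\<Sum>M\<in>?J. 2 powr (- real n * \<mu>))"
  proof (intro sum_mono)
    fix M assume M: "M \<in> ?J"
    then have ne: "M \<noteq> {#}" and sz: "size M = n" using assms by auto
    show "measure_pmf.prob ?Q {xs. mset xs = M} \<le> 2 powr (- real n * \<mu>)"
    proof (cases "set_mset M \<subseteq> set_pmf pX")
      case True
      have "exponent_E R pX \<le> rel_entropy (pmf_of_multiset M) pX"
        unfolding exponent_E_def using M by (intro INF_lower) auto
      then show ?thesis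
        using prob_type_class_le[OF ne True] assms(2) sz by (meson order.trans)
    next
      case False
      then show ?thesis using prob_type_class_eq_0[OF ne False] sz by simp
    qed
  qed
  also have "\<dots> \<le> real (card ?I) * 2 powr (- real n * \<mu>)"
  proof -
    have "card ?J \<le> card ?I" using fin by (intro card_mono) auto
    then show ?thesis by (simp add: mult_right_mono)
  qed
  also have "\<dots> \<le> real ((n + 1) ^ CARD('a)) * 2 powr (- real n * \<mu>)"
    using card_multisets_of_size_UNIV_le[where 'a = 'a] by (intro mult_right_mono of_nat_mono) auto
  finally show ?thesis by (simp add: of_nat_power)
qed

text \<open>Sequences of the same type are equally likely, so a key conditioned on its type is
  uniform on the class. The law of the hash is therefore a mixture of laws that do not depend on
  \<open>p\<close>; only the weights do.\<close>

lemma pmf_map_replicate_pmf_eq_sum: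
  fixes p :: "'a :: finite pmf"
  shows "pmf (map_pmf h (replicate_pmf n p)) y = (\<Sum>M | size M = n.
    measure_pmf.prob (replicate_pmf n p) {xs. mset xs = M} *
      (card {k \<in> {xs. mset xs = M}. h k = y} / card {xs. mset xs = M}))"
proof -
  let ?P = "replicate_pmf n p"
  let ?I = "{M :: 'a multiset. size M = n}"
  have fin: "finite ?I" by (rule finite_multisets_of_size_UNIV)
  have "pmf (map_pmf h ?P) y = measure_pmf.prob ?P (\<Union>M\<in>?I. {k \<in> {xs. mset xs = M}. h k = y})"
    unfolding pmf_map by (intro measure_eq_AE) (auto simp: AE_measure_pmf_iff set_replicate_pmf)
  also have "\<dots> = (\<Sum>M\<in>?I. measure_pmf.prob ?P {k \<in> {xs. mset xs = M}. h k = y})"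
    using fin by (intro measure_pmf.finite_measure_finite_Union) (auto simp: disjoint_family_on_def)
  also have "\<dots> = (\<Sum>M\<in>?I. measure_pmf.prob ?P {xs. mset xs = M} *
      (card {k \<in> {xs. mset xs = M}. h k = y} / card {xs. mset xs = M}))"
  proof (intro sum.cong refl)
    fix M assume M: "M \<in> ?I"
    define c where "c = (\<Prod>a\<in>UNIV. pmf p a ^ count M a)"
    have prob: "measure_pmf.prob ?P A = card A * c" if "A \<subseteq> {xs. mset xs = M}" for A
    proof -
      have "finite A" using that by (rule finite_subset) simp
      then have "measure_pmf.prob ?P A = sum (pmf ?P) A" by (rule measure_measure_pmf_finite)
      also have "\<dots> = (\<Sum>xs\<in>A. c)"
        using that M by (intro sum.cong refl) (auto simp: pmf_replicate_pmf prod_list_eq_prod_count c_def)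
      finally show ?thesis by simp
    qed
    obtain xs where "mset xs = M" by (rule ex_mset[THEN exE])
    then have "card {xs. mset xs = M} \<noteq> 0" by auto
    then show "measure_pmf.prob ?P {k \<in> {xs. mset xs = M}. h k = y} =
        measure_pmf.prob ?P {xs. mset xs = M} *
        (card {k \<in> {xs. mset xs = M}. h k = y} / card {xs. mset xs = M})"
      by (subst (1 2) prob) auto
  qed
  finally show ?thesis .
qed

text \<open>For a key that is uniform on \<open>T\<close>, the divergence of the hash value from the uniform law is at
  most the chi-square distance, which for a balanced hash is of order \<open>card B / card T\<close>.\<close>

lemma hash_divergence_le:
  fixes h :: "'k \<Rightarrow> 'y" and B :: "'y set"
  assumes "finite T" "T \<noteq> {}" "finite B" "B \<noteq> {}" "h ` T \<subseteq> B"
  defines "t \<equiv> \<lambda>y. card B * (card {k \<in> T. h k = y} / card T)"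
  shows "(\<Sum>y\<in>B. t y * ln (t y)) / card B \<le> ln (card B)"
    and "(\<Sum>y\<in>B. t y * ln (t y)) / card B \<le> card B / (card T)\<^sup>2 * fibre_deviation B T h"
proof -
  have T: "0 < real (card T)" and B: "0 < real (card B)"
    using assms by (auto simp: card_gt_0_iff)
  \<comment> \<open>\<open>t\<close> is the density of the hash value relative to the uniform law on
    \<open>B\<close>, so its mean over \<open>B\<close> is 1.\<close>
  have sum_t: "(\<Sum>y\<in>B. t y) = card B"
  proof -
    have "(\<Sum>y\<in>B. t y) = card B * (real (\<Sum>y\<in>B. card {k \<in> T. h k = y}) / card T)"
      by (simp add: t_def sum_distrib_left sum_divide_distrib)
    then show ?thesis using T by (simp only: sum_card_fibres[OF assms(1,3,5)]) simp
  qed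
  have t: "0 \<le> t y" "t y \<le> card B" for y
  proof -
    have "card {k \<in> T. h k = y} \<le> card T" using assms(1) by (intro card_mono) auto
    then have "card {k \<in> T. h k = y} / card T \<le> 1" using T by simp
    then show "t y \<le> card B" unfolding t_def using B by (intro mult_left_le) auto
  qed (simp add: t_def)
  have "(\<Sum>y\<in>B. t y * ln (t y)) \<le> (\<Sum>y\<in>B. t y * ln (card B))"
  proof (intro sum_mono)
    fix y
    show "t y * ln (t y) \<le> t y * ln (card B)"
      using t[of y] by (cases "t y = 0") (auto intro!: mult_left_mono)
  qed
  also have "\<dots> = card B * ln (card B)" by (simp add: sum_t flip: sum_distrib_right)
  finally show "(\<Sum>y\<in>B. t y * ln (t y)) / card B \<le> ln (card B)"
    using B by (simp add: divide_le_eq mult.commute)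
  have "(\<Sum>y\<in>B. t y * ln (t y)) \<le> (\<Sum>y\<in>B. (t y - 1)\<^sup>2 + (t y - 1))"
    using t by (intro sum_mono mult_ln_le_quadratic)
  also have "\<dots> = (\<Sum>y\<in>B. (t y - 1)\<^sup>2)"
    by (simp add: sum.distrib sum_subtractf sum_t)
  also have "\<dots> = (\<Sum>y\<in>B. (card B / card T)\<^sup>2 * (real (card {k \<in> T. h k = y}) - card T / card B)\<^sup>2)"
    unfolding power_mult_distrib[symmetric] t_def using T B
    by (intro sum.cong refl arg_cong[where f = "\<lambda>x. x\<^sup>2"]) (simp add: field_simps)
  also have "\<dots> = (card B / card T)\<^sup>2 * fibre_deviation B T h"
    by (simp add: fibre_deviation_def sum_distrib_left)
  finally have "(\<Sum>y\<in>B. t y * ln (t y)) / card B \<le> (card B / card T)\<^sup>2 * fibre_deviation B T h / card B"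
    using B by (intro divide_right_mono) auto
  also have "\<dots> = card B / (card T)\<^sup>2 * fibre_deviation B T h"
    using B by (simp add: power2_eq_square field_simps)
  finally show "(\<Sum>y\<in>B. t y * ln (t y)) / card B \<le> card B / (card T)\<^sup>2 * fibre_deviation B T h" .
qed

text \<open>Convexity reduces the claim to one type of the key at a time. If its entropy is at most
  \<open>R\<close>, the divergence is at most \<open>m\<close> bits and the probability of the type
  already decays as required; otherwise the balance of the hash supplies the additional factor. The
  constant \<open>c\<close> bounds at once the number of types, the imbalance of the hash and, up to
  a factor 2, the excess of \<open>2 ^ m\<close> over \<open>2 powr (n * R)\<close>.\<close>

lemma hashed_key_divergence_le:
  fixes pK :: "'a :: finite pmf" and h :: "'a list \<Rightarrow> bool list" and c :: real
  assumes n: "0 < n" and F: "ereal \<mu> \<le> exponent_F R pK"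
    and h: "h ` {xs. length xs = n} \<subseteq> {y. length y = m}"
    and dev: "\<And>M. size M = n \<Longrightarrow>
      fibre_deviation {y. length y = m} {xs. mset xs = M} h \<le> c * card {xs. mset xs = M}"
    and c: "real (n + 1) ^ CARD('a) \<le> c" and m: "2 ^ m \<le> 2 * c * 2 powr (n * R)"
  defines "q \<equiv> pmf (map_pmf h (replicate_pmf n pK))"
  shows "(\<Sum>y | length y = m. q y * log 2 (q y * 2 ^ m)) \<le>
    c * (m + 2 * c\<^sup>2 / ln 2) * 2 powr (- real n * \<mu>)"
proof -
  let ?I = "{M :: 'a multiset. size M = n}"
  let ?B = "{y :: bool list. length y = m}"
  let ?P = "replicate_pmf n pK"
  define T :: "'a multiset \<Rightarrow> 'a list set" where "T M = {xs. mset xs = M}" for M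
  define \<pi> where "\<pi> M = measure_pmf.prob ?P (T M)" for M
  define t where "t M y = 2 ^ m * (card {k \<in> T M. h k = y} / card (T M))" for M y
  \<comment> \<open>The divergence, in nats, of the hash of a key uniform on \<open>T M\<close> from
    the uniform law on strings of \<open>m\<close> bits.\<close>
  define A where "A M = (\<Sum>y\<in>?B. t M y * ln (t M y)) / 2 ^ m" for M
  have cardB: "card ?B = 2 ^ m" by (simp add: card_lists_of_length)
  have fin: "finite ?I" by (rule finite_multisets_of_size_UNIV)
  have c1: "1 \<le> c" by (rule order.trans[OF one_le_power c]) simp
  have T: "finite (T M)" "T M \<noteq> {}" "h ` T M \<subseteq> ?B" if "M \<in> ?I" for M
  proof -
    show "T M \<noteq> {}" using ex_mset[of M] by (auto simp: T_def)
    have "T M \<subseteq> {xs. length xs = n}" using that by (auto simp: T_def)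
    then show "h ` T M \<subseteq> ?B" using h by blast
  qed (simp add: T_def)
  have q: "2 ^ m * q y = (\<Sum>M\<in>?I. \<pi> M * t M y)" for y
    unfolding q_def pmf_map_replicate_pmf_eq_sum T_def[symmetric] \<pi>_def[symmetric]
    by (simp add: t_def sum_distrib_left mult.left_commute)
  have sum_\<pi>: "sum \<pi> ?I = 1"
  proof -
    have "sum \<pi> ?I = measure_pmf.prob ?P (\<Union>M\<in>?I. T M)"
      unfolding \<pi>_def using fin
      by (intro measure_pmf.finite_measure_finite_Union[symmetric]) (auto simp: disjoint_family_on_def T_def)
    also have "\<dots> = 1"
      by (subst measure_pmf.prob_eq_1) (auto simp: AE_measure_pmf_iff set_replicate_pmf T_def)
    finally show ?thesis .
  qed
  have A: "A M \<le> m * ln 2" "A M \<le> 2 ^ m * c / card (T M)" if M: "M \<in> ?I" for M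
  proof -
    have B: "finite ?B" "?B \<noteq> {}" using Ex_list_of_length by auto
    note d = hash_divergence_le[OF T(1,2)[OF M] B T(3)[OF M], folded cardB]
    show "A M \<le> m * ln 2"
      using d(1) by (simp add: A_def t_def cardB ln_realpow)
    have "card (T M) > 0" using T[OF M] by (simp add: card_gt_0_iff)
    have "A M \<le> 2 ^ m / (card (T M))\<^sup>2 * fibre_deviation ?B (T M) h"
      using d(2) by (simp add: A_def t_def cardB)
    also have "\<dots> \<le> 2 ^ m / (card (T M))\<^sup>2 * (c * card (T M))"
      using dev[of M] M by (intro mult_left_mono) (auto simp: T_def)
    also have "\<dots> = 2 ^ m * c / card (T M)"
      using \<open>card (T M) > 0\<close> by (simp add: power2_eq_square)
    finally show "A M \<le> 2 ^ m * c / card (T M)" .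
  qed
  have \<pi>A: "\<pi> M * A M \<le> (m * ln 2 + 2 * c\<^sup>2) * 2 powr (- real n * \<mu>)" if M: "M \<in> ?I" for M
  proof (cases "set_mset M \<subseteq> set_pmf pK")
    case True
    let ?E = "pmf_of_multiset M"
    have ne: "M \<noteq> {#}" and sz: "size M = n" using M n by auto
    define d where "d = real_of_ereal (rel_entropy ?E pK)"
    have d: "rel_entropy ?E pK = ereal d"
      using True ne by (simp add: d_def rel_entropy_eq_sum)
    have "exponent_F R pK \<le> ereal (max 0 (shannon_entropy ?E - R)) + rel_entropy ?E pK"
      unfolding exponent_F_def by (intro INF_lower) auto
    with F have "ereal \<mu> \<le> ereal (max 0 (shannon_entropy ?E - R)) + rel_entropy ?E pK"
      by (rule order.trans)
    then have \<mu>: "\<mu> \<le> max 0 (shannon_entropy ?E - R) + d"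
      by (simp only: d plus_ereal.simps(1) ereal_less_eq(3))
    have \<pi>: "\<pi> M = card (T M) * 2 powr (- real n * (shannon_entropy ?E + d))"
      using prob_type_class[OF ne True] by (simp add: \<pi>_def T_def d_def sz)
    show ?thesis
    proof (cases "shannon_entropy ?E \<le> R")
      case True
      then have "\<mu> \<le> d" using \<mu> by simp
      then have le: "\<pi> M \<le> 2 powr (- real n * \<mu>)"
        using prob_type_class_le[OF ne \<open>set_mset M \<subseteq> set_pmf pK\<close>, of \<mu>]
        by (simp add: d \<pi>_def T_def sz)
      have "\<pi> M * A M \<le> \<pi> M * (m * ln 2)"
        using A(1)[OF M] by (intro mult_left_mono) (auto simp: \<pi>_def)
      also have "\<dots> \<le> 2 powr (- real n * \<mu>) * (m * ln 2)"
        using le by (intro mult_right_mono) auto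
      also have "\<dots> \<le> 2 powr (- real n * \<mu>) * (m * ln 2 + 2 * c\<^sup>2)"
        by (intro mult_left_mono) auto
      finally show ?thesis by (simp add: mult.commute)
    next
      case False
      then have le: "\<mu> \<le> shannon_entropy ?E - R + d" using \<mu> by simp
      have "card (T M) > 0" using T[OF M] by (simp add: card_gt_0_iff)
      have "\<pi> M * A M \<le> \<pi> M * (2 ^ m * c / card (T M))"
        using A(2)[OF M] by (intro mult_left_mono) (auto simp: \<pi>_def)
      \<comment> \<open>The size of the class cancels here: it is a factor of \<open>\<pi> M\<close>
        and a divisor in the bound on \<open>A M\<close>.\<close>
      also have "\<dots> = 2 ^ m * (c * 2 powr (- real n * (shannon_entropy ?E + d)))"
        using \<open>card (T M) > 0\<close> by (simp add: \<pi>)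
      also have "\<dots> \<le> 2 * c * 2 powr (n * R) * (c * 2 powr (- real n * (shannon_entropy ?E + d)))"
        using m c1 by (intro mult_right_mono) auto
      also have "\<dots> = 2 * c\<^sup>2 * 2 powr (- real n * (shannon_entropy ?E - R + d))"
      proof -
        have "2 powr (- real n * (shannon_entropy ?E - R + d)) =
            2 powr (n * R) * 2 powr (- real n * (shannon_entropy ?E + d))"
          by (simp add: algebra_simps flip: powr_add)
        then show ?thesis by (simp only: power2_eq_square mult_ac)
      qed
      also have "\<dots> \<le> 2 * c\<^sup>2 * 2 powr (- real n * \<mu>)"
        using le by (intro mult_left_mono) (auto intro: mult_left_mono)
      also have "\<dots> \<le> (m * ln 2 + 2 * c\<^sup>2) * 2 powr (- real n * \<mu>)"
        by (intro mult_right_mono) auto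
      finally show ?thesis .
    qed
  next
    case False
    have "M \<noteq> {#}" "size M = n" using M n by auto
    then have "\<pi> M = 0"
      using prob_type_class_eq_0[OF _ False] by (simp add: \<pi>_def T_def)
    then show ?thesis by simp
  qed
  have "(\<Sum>y\<in>?B. q y * ln (2 ^ m * q y)) = (\<Sum>y\<in>?B. (2 ^ m * q y) * ln (2 ^ m * q y)) / 2 ^ m"
    by (simp add: sum_divide_distrib mult.assoc)
  \<comment> \<open>By fact \<open>q\<close>, the density of the hash of the key is the mixture of
    the densities \<open>t M\<close> with weights \<open>\<pi> M\<close>, so Jensen's inequality
    applies at each \<open>y\<close>.\<close>
  also have "\<dots> \<le> (\<Sum>y\<in>?B. \<Sum>M\<in>?I. \<pi> M * (t M y * ln (t M y))) / 2 ^ m"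
    unfolding q using fin sum_\<pi>
    by (intro divide_right_mono sum_mono mult_ln_sum_le) (auto simp: \<pi>_def t_def)
  also have "\<dots> = (\<Sum>M\<in>?I. \<pi> M * A M)"
    by (subst sum.swap) (simp add: A_def sum_divide_distrib sum_distrib_left)
  also have "\<dots> \<le> (\<Sum>M\<in>?I. (m * ln 2 + 2 * c\<^sup>2) * 2 powr (- real n * \<mu>))"
    using \<pi>A by (intro sum_mono)
  also have "\<dots> = real (card ?I) * ((m * ln 2 + 2 * c\<^sup>2) * 2 powr (- real n * \<mu>))"
    by simp
  also have "\<dots> \<le> c * ((m * ln 2 + 2 * c\<^sup>2) * 2 powr (- real n * \<mu>))"
  proof (intro mult_right_mono)
    have "real (card ?I) \<le> real ((n + 1) ^ CARD('a))"
      using card_multisets_of_size_UNIV_le[where 'a = 'a] by (intro of_nat_mono)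
    then show "real (card ?I) \<le> c" using c by (simp add: of_nat_power)
  qed auto
  finally have "(\<Sum>y\<in>?B. q y * ln (2 ^ m * q y)) / ln 2 \<le>
      c * ((m * ln 2 + 2 * c\<^sup>2) * 2 powr (- real n * \<mu>)) / ln 2"
    by (intro divide_right_mono) auto
  also have "c * ((m * ln 2 + 2 * c\<^sup>2) * 2 powr (- real n * \<mu>)) / ln 2 =
      c * (m + 2 * c\<^sup>2 / ln 2) * 2 powr (- real n * \<mu>)"
    by (simp add: add_divide_distrib distrib_left distrib_right)
  finally have "(\<Sum>y\<in>?B. q y * ln (2 ^ m * q y) / ln 2) \<le> \<dots>"
    by (simp only: sum_divide_distrib)
  then show ?thesis
    by (simp only: log_def times_divide_eq_right mult.commute[of "q _" "2 ^ m"])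
qed

section \<open>The encryption scheme\<close>

definition xor_list :: "bool list \<Rightarrow> bool list \<Rightarrow> bool list" where
  "xor_list = map2 (\<noteq>)"

lemma length_xor_list [simp]: "length (xor_list u v) = min (length u) (length v)"
  by (simp add: xor_list_def)

lemma xor_list_cancel_left: "length u = length v \<Longrightarrow> xor_list u (xor_list u v) = v"
  by (induction u v rule: list_induct2) (auto simp: xor_list_def)

lemma xor_list_cancel_right: "length u = length v \<Longrightarrow> xor_list (xor_list u v) v = u"
  by (induction u v rule: list_induct2) (auto simp: xor_list_def)

definition encrypt ::
  "'a list set \<Rightarrow> ('a list \<Rightarrow> bool list) \<Rightarrow> ('a list \<Rightarrow> bool list) \<Rightarrow> ('a list \<Rightarrow> bool list) \<Rightarrow>
    'a list \<Rightarrow> 'a list \<Rightarrow> bool list" where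
  "encrypt S h f g k x = (if x \<in> S then False # xor_list (h k) (f x) else True # g x)"

text \<open>The inverse of the encryption under the given key. On strings that are no codewords it
  returns a fixed list of length \<open>n\<close>, since the decoder has to stay inside the
  plaintext space.\<close>

definition decrypt :: "nat \<Rightarrow> ('a list \<Rightarrow> 'a list \<Rightarrow> bool list) \<Rightarrow> 'a list \<Rightarrow> bool list \<Rightarrow> 'a list" where
  "decrypt n \<Phi> k c = (if \<exists>x. length x = n \<and> \<Phi> k x = c then SOME x. length x = n \<and> \<Phi> k x = c
     else replicate n undefined)"

lemma is_scheme_decrypt:
  assumes "\<And>k x. \<Phi> k x \<noteq> []" "\<And>k. length k = n \<Longrightarrow> inj_on (\<Phi> k) {x. length x = n}"
  shows "is_scheme n \<Phi> (decrypt n \<Phi>)"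
proof -
  have "length (decrypt n \<Phi> k c) = n" for k c
  proof (cases "\<exists>x. length x = n \<and> \<Phi> k x = c")
    case True
    then show ?thesis using someI_ex[OF True] by (simp add: decrypt_def)
  next
    case False
    then show ?thesis by (simp only: decrypt_def if_False length_replicate)
  qed
  moreover have "decrypt n \<Phi> k (\<Phi> k x) = x" if "length k = n" "length x = n" for k x
  proof -
    have "(SOME x'. length x' = n \<and> \<Phi> k x' = \<Phi> k x) = x"
      using assms(2)[OF that(1)] that(2) by (intro some_equality) (auto dest: inj_onD)
    then show ?thesis using that(2) by (auto simp: decrypt_def)
  qed
  ultimately show ?thesis using assms(1) by (simp add: is_scheme_def)
qed

text \<open>Masked codewords carry \<open>m\<close> bits and plain ones \<open>l\<close> bits after
  the flag. No source or key law occurs among the parameters, which is what makes the scheme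
  universal.\<close>

locale hash_encryption =
  fixes n m l :: nat and R c :: real
    and h f g :: "'a :: finite list \<Rightarrow> bool list"
  assumes n: "0 < n"
    and hash: "h ` {xs. length xs = n} \<subseteq> {y. length y = m}"
    and balanced: "\<And>M. size M = n \<Longrightarrow>
      fibre_deviation {y. length y = m} {xs. mset xs = M} h \<le> c * card {xs. mset xs = M}"
    and f: "f ` low_entropy n R \<subseteq> {y. length y = m}" "inj_on f (low_entropy n R)"
    and g: "g ` {xs. length xs = n} \<subseteq> {y. length y = l}" "inj_on g {xs. length xs = n}"
    and c: "real (n + 1) ^ CARD('a) \<le> c" and m: "2 ^ m \<le> 2 * c * 2 powr (n * R)"
begin

definition "\<Phi> = encrypt (low_entropy n R) h f g"

text \<open>The flag bit separates the two kinds of codewords and keeps them nonempty. For a known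
  key the mask is undone by applying it again, and \<open>f\<close> and \<open>g\<close> are
  injective.\<close>

lemma is_scheme: "is_scheme n \<Phi> (decrypt n \<Phi>)"
proof (rule is_scheme_decrypt)
  fix k :: "'a list" assume "length k = n"
  then have k: "length (h k) = m" using hash by auto
  show "inj_on (\<Phi> k) {x. length x = n}"
  proof (rule inj_onI)
    fix x x' :: "'a list"
    assume x: "x \<in> {x. length x = n}" "x' \<in> {x. length x = n}" and eq: "\<Phi> k x = \<Phi> k x'"
    show "x = x'"
    proof (cases "x \<in> low_entropy n R")
      case True
      then have x': "x' \<in> low_entropy n R" and "xor_list (h k) (f x) = xor_list (h k) (f x')"
        using eq by (auto simp: \<Phi>_def encrypt_def split: if_splits)
      moreover have "length (f x) = m" "length (f x') = m" using f(1) True x' by auto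
      ultimately have "f x = f x'" using k xor_list_cancel_left by metis
      then show ?thesis using f(2) True x' by (auto dest: inj_onD)
    next
      case False
      then have "g x = g x'"
        using eq by (auto simp: \<Phi>_def encrypt_def split: if_splits)
      then show ?thesis using g(2) x by (auto dest: inj_onD)
    qed
  qed
qed (simp add: \<Phi>_def encrypt_def)

text \<open>A masked codeword has length \<open>1 + m\<close>; a plain one is charged
  \<open>l\<close> more, on an event of exponentially small probability.\<close>

lemma avg_length_le:
  fixes pX pK :: "'a pmf" and \<mu> :: real
  assumes "ereal \<mu> \<le> exponent_E R pX"
  shows "avg_length n \<Phi> pX pK \<le> 1 + m + l * (c * 2 powr (- real n * \<mu>))"
proof -
  let ?KX = "key_source n pK pX"
  let ?bad = "UNIV \<times> (- low_entropy n R) :: ('a list \<times> 'a list) set"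
  have fin: "finite (set_pmf ?KX)" by (simp add: key_source_def)
  have int: "integrable (measure_pmf ?KX) u" for u :: "_ \<Rightarrow> real"
    using fin by (rule integrable_measure_pmf_finite)
  have "avg_length n \<Phi> pX pK \<le> measure_pmf.expectation ?KX (\<lambda>z. 1 + real m + real l * indicat_real ?bad z)"
    unfolding avg_length_def
  proof (intro integral_mono_AE int)
    have "real (length (\<Phi> k x)) \<le> 1 + real m + real l * indicat_real ?bad (k, x)"
      if "length k = n" "length x = n" for k x
    proof (cases "x \<in> low_entropy n R")
      case True
      then have "length (f x) = m" "length (h k) = m" using f(1) hash that(1) by auto
      then show ?thesis using True by (simp add: \<Phi>_def encrypt_def)
    next
      case False
      have "length (g x) = l" using g(1) that(2) by auto
      then show ?thesis using False by (simp add: \<Phi>_def encrypt_def)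
    qed
    then show "AE z in ?KX. (\<lambda>(k, x). real (length (\<Phi> k x))) z \<le> 1 + real m + real l * indicat_real ?bad z"
      by (auto simp only: AE_measure_pmf_iff key_source_def set_replicate_pmf set_pair_pmf)
  qed
  also have "\<dots> = 1 + m + l * measure_pmf.prob ?KX ?bad"
    by (simp add: int)
  also have "measure_pmf.prob ?KX ?bad = measure_pmf.prob (replicate_pmf n pX) (- low_entropy n R)"
    by (simp add: key_source_def measure_pmf_prob_product)
  also have "\<dots> \<le> real (n + 1) ^ CARD('a) * 2 powr (- real n * \<mu>)"
    by (rule prob_not_low_entropy_le[OF n assms])
  also have "\<dots> \<le> c * 2 powr (- real n * \<mu>)"
    using c by (intro mult_right_mono) auto
  finally show ?thesis by (simp add: mult_left_mono)
qed

text \<open>The reference output law puts mass \<open>1 - \<epsilon>\<close> uniformly on the masked codewords and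
  mass \<open>\<epsilon>\<close> uniformly on the plain ones.\<close>

lemma Delta_MI_le_hash_divergence:
  fixes pX pK :: "'a pmf"
  assumes "0 < \<epsilon>" "\<epsilon> < 1"
  defines "q \<equiv> pmf (map_pmf h (replicate_pmf n pK))"
  assumes \<kappa>: "0 \<le> \<kappa>" "(\<Sum>y | length y = m. q y * log 2 (q y * 2 ^ m)) \<le> \<kappa>"
  shows "Delta_MI n \<Phi> pX pK \<le> \<kappa> - log 2 (1 - \<epsilon>) +
    measure_pmf.prob (replicate_pmf n pX) (- low_entropy n R) * (l - log 2 \<epsilon>)"
proof -
  let ?S = "low_entropy n R :: 'a list set"
  define P where "P = replicate_pmf n pK"
  define Q where "Q = replicate_pmf n pX"
  define W where "W x = map_pmf (\<lambda>k. \<Phi> k x) P" for x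
  define V where "V b = (if hd b then \<epsilon> / 2 ^ l else (1 - \<epsilon>) / 2 ^ m)" for b :: "bool list"
  define B where "B = Cons False ` {y. length y = m} \<union> Cons True ` {y. length y = l}"
  have setP: "length k = n" if "k \<in> set_pmf P" for k
    using that by (auto simp: P_def set_replicate_pmf)
  have setQ: "length x = n" if "x \<in> set_pmf Q" for x
    using that by (auto simp: Q_def set_replicate_pmf)
  have finQ: "finite (set_pmf Q)" by (simp add: Q_def)
  have \<kappa>': "0 \<le> \<kappa> - log 2 (1 - \<epsilon>)"
    using assms(1,2) \<kappa>(1) by (simp add: log_le_zero_cancel_iff order.trans[of _ 0])
  have "sum V B = sum V (Cons False ` {y. length y = m}) + sum V (Cons True ` {y. length y = l})"
    unfolding B_def by (intro sum.union_disjoint) auto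
  also have "\<dots> = 1"
    by (simp add: sum.reindex V_def card_lists_of_length)
  finally have sumV: "sum V B \<le> 1" by simp
  have sub: "set_pmf (W x) \<subseteq> B" if "x \<in> set_pmf Q" for x
  proof
    fix b assume "b \<in> set_pmf (W x)"
    then obtain k where k: "k \<in> set_pmf P" "b = \<Phi> k x" by (auto simp: W_def)
    have "length (h k) = m" using hash setP[OF k(1)] by auto
    moreover have "length (f x) = m" if "x \<in> ?S" using f(1) that by auto
    moreover have "length (g x) = l" using g(1) setQ[OF \<open>x \<in> set_pmf Q\<close>] by auto
    ultimately show "b \<in> B" by (simp add: k(2) B_def \<Phi>_def encrypt_def)
  qed
  \<comment> \<open>For fixed \<open>x\<close> the mask permutes the strings of \<open>m\<close>
    bits, so the divergence is that of the hashed key from the uniform law, plus the price of giving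
    this part only mass \<open>1 - \<epsilon>\<close> in \<open>V\<close>.\<close>
  have low: "(\<Sum>b\<in>set_pmf (W x). pmf (W x) b * log 2 (pmf (W x) b / V b)) \<le> \<kappa> - log 2 (1 - \<epsilon>)"
    if x: "x \<in> ?S" for x
  proof -
    let ?H = "map_pmf h P"
    let ?e = "\<lambda>y. False # xor_list y (f x)"
    have lf: "length (f x) = m" using f(1) x by auto
    have setH: "set_pmf ?H \<subseteq> {y. length y = m}" using hash setP by auto
    have inj: "inj_on ?e (set_pmf ?H)"
    proof (rule inj_on_inverseI[of _ "\<lambda>b. xor_list (tl b) (f x)"])
      fix y assume "y \<in> set_pmf ?H"
      then have "length y = length (f x)" using setH lf by auto
      then show "xor_list (tl (?e y)) (f x) = y" by (simp add: xor_list_cancel_right)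
    qed
    have W: "W x = map_pmf ?e ?H"
      using x by (simp add: W_def \<Phi>_def encrypt_def map_pmf_comp)
    have "(\<Sum>b\<in>set_pmf (W x). pmf (W x) b * log 2 (pmf (W x) b / V b)) =
        (\<Sum>y\<in>set_pmf ?H. q y * log 2 (q y * 2 ^ m / (1 - \<epsilon>)))"
      unfolding W set_map_pmf[of ?e]
    proof (subst sum.reindex[OF inj], intro sum.cong refl)
      fix y assume y: "y \<in> set_pmf ?H"
      have "pmf (map_pmf ?e ?H) (?e y) = q y"
        using pmf_map_inj[OF inj y] by (simp only: q_def P_def)
      then show "((\<lambda>b. pmf (map_pmf ?e ?H) b * log 2 (pmf (map_pmf ?e ?H) b / V b)) \<circ> ?e) y =
          q y * log 2 (q y * 2 ^ m / (1 - \<epsilon>))"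
        by (simp only: o_def) (simp add: V_def)
    qed
    also have "\<dots> = (\<Sum>y\<in>set_pmf ?H. q y * log 2 (q y * 2 ^ m) - q y * log 2 (1 - \<epsilon>))"
    proof (intro sum.cong refl)
      fix y assume "y \<in> set_pmf ?H"
      then have "0 < q y" by (simp add: q_def P_def pmf_positive_iff del: set_map_pmf)
      then show "q y * log 2 (q y * 2 ^ m / (1 - \<epsilon>)) = q y * log 2 (q y * 2 ^ m) - q y * log 2 (1 - \<epsilon>)"
        using assms(2) by (simp add: log_divide right_diff_distrib)
    qed
    also have "\<dots> = (\<Sum>y\<in>set_pmf ?H. q y * log 2 (q y * 2 ^ m)) - log 2 (1 - \<epsilon>)"
    proof -
      have "sum q (set_pmf ?H) = 1"
        unfolding q_def P_def[symmetric] by (intro sum_pmf_eq_1) (auto simp: P_def)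
      then show ?thesis by (simp add: sum_subtractf flip: sum_distrib_right)
    qed
    also have "(\<Sum>y\<in>set_pmf ?H. q y * log 2 (q y * 2 ^ m)) = (\<Sum>y | length y = m. q y * log 2 (q y * 2 ^ m))"
      using setH by (intro sum.mono_neutral_left) (auto simp: q_def P_def set_pmf_iff simp del: set_map_pmf)
    finally show ?thesis using \<kappa>(2) by simp
  qed
  \<comment> \<open>A plain codeword does not depend on the key, so its law is a point mass and the
    divergence is minus the logarithm of its \<open>V\<close>-mass.\<close>
  have high: "(\<Sum>b\<in>set_pmf (W x). pmf (W x) b * log 2 (pmf (W x) b / V b)) = l - log 2 \<epsilon>"
    if x: "x \<notin> ?S" for x
  proof -
    have "W x = return_pmf (True # g x)"
      using x by (simp add: W_def \<Phi>_def encrypt_def)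
    then show ?thesis using assms(1) by (simp add: V_def log_divide log_nat_power)
  qed
  have "Delta_MI n \<Phi> pX pK \<le>
      (\<Sum>x\<in>set_pmf Q. pmf Q x * (\<Sum>b\<in>set_pmf (W x). pmf (W x) b * log 2 (pmf (W x) b / V b)))"
    unfolding W_def P_def Q_def
  proof (rule Delta_MI_le[of B])
    show "finite B" by (simp add: B_def)
    show "0 < V b" for b using assms(1,2) by (simp add: V_def)
    show "set_pmf (map_pmf (\<lambda>k. \<Phi> k x) (replicate_pmf n pK)) \<subseteq> B"
      if "x \<in> set_pmf (replicate_pmf n pX)" for x
      using sub[of x] that by (simp add: W_def P_def Q_def)
  qed (rule sumV)
  \<comment> \<open>The term for masked plaintexts is nonnegative by \<open>\<kappa>'\<close> and is
    therefore charged to every \<open>x\<close>.\<close>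
  also have "\<dots> \<le> (\<Sum>x\<in>set_pmf Q. pmf Q x * (\<kappa> - log 2 (1 - \<epsilon>) + indicator (- ?S) x * (l - log 2 \<epsilon>)))"
    using low high \<kappa>' by (intro sum_mono mult_left_mono) (auto split: split_indicator)
  also have "\<dots> = (\<Sum>x\<in>set_pmf Q. pmf Q x) * (\<kappa> - log 2 (1 - \<epsilon>)) +
      (\<Sum>x\<in>set_pmf Q. pmf Q x * indicator (- ?S) x) * (l - log 2 \<epsilon>)"
    by (simp add: distrib_left sum.distrib sum_distrib_right mult.assoc)
  also have "(\<Sum>x\<in>set_pmf Q. pmf Q x) = 1"
    using finQ by (simp add: sum_pmf_eq_1)
  also have "(\<Sum>x\<in>set_pmf Q. pmf Q x * indicator (- ?S) x) = measure_pmf.expectation Q (indicator (- ?S))"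
    using finQ by (subst integral_measure_pmf_real[of "set_pmf Q"]) (auto simp: mult.commute)
  finally show ?thesis by (simp add: Q_def)
qed

lemma Delta_MI_le_exponent:
  fixes pX pK :: "'a pmf" and \<mu> :: real
  assumes \<mu>: "0 < \<mu>" "ereal \<mu> \<le> exponent_E R pX" "ereal \<mu> \<le> exponent_F R pK"
  shows "Delta_MI n \<Phi> pX pK \<le>
    (c * (m + 2 * c\<^sup>2 / ln 2) + 1 / ((1 - 2 powr - \<mu>) * ln 2) + c * (l + n * \<mu>)) * 2 powr (- real n * \<mu>)"
proof -
  \<comment> \<open>This choice makes \<open>- log 2 (1 - \<epsilon>)\<close> of order \<epsilon>,
    whereas \<open>- log 2 \<epsilon>\<close> is only linear in \<open>n\<close>.\<close>
  define \<epsilon> where "\<epsilon> = 2 powr (- real n * \<mu>)"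
  define e where "e = 2 powr - \<mu>"
  have "\<mu> \<le> n * \<mu>" using \<mu>(1) n by (simp add: Suc_le_eq)
  then have \<epsilon>: "0 < \<epsilon>" "\<epsilon> \<le> e" "e < 1"
    using powr_less_mono[of "- \<mu>" 0 2] \<mu>(1) by (auto simp: \<epsilon>_def e_def)
  have c1: "1 \<le> c" by (rule order.trans[OF one_le_power c]) simp
  let ?\<kappa> = "c * (m + 2 * c\<^sup>2 / ln 2) * \<epsilon>"
  have le: "Delta_MI n \<Phi> pX pK \<le> ?\<kappa> - log 2 (1 - \<epsilon>) +
    measure_pmf.prob (replicate_pmf n pX) (- low_entropy n R) * (l - log 2 \<epsilon>)"
    using \<epsilon> c1 hashed_key_divergence_le[OF n \<mu>(3) hash balanced c m]
    by (intro Delta_MI_le_hash_divergence) (auto simp: \<epsilon>_def)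
  \<comment> \<open>\<open>e\<close> is the value of \<epsilon> at \<open>n = 1\<close> and
    dominates it for all larger \<open>n\<close>, so the constant depends on \<mu> alone.\<close>
  have log: "- log 2 (1 - \<epsilon>) \<le> 1 / ((1 - e) * ln 2) * \<epsilon>"
  proof -
    have "0 < 1 - \<epsilon>" using \<epsilon> by simp
    then have "ln (1 / (1 - \<epsilon>)) \<le> 1 / (1 - \<epsilon>) - 1"
      by (intro ln_le_minus_one) simp
    also have "\<dots> = \<epsilon> / (1 - \<epsilon>)" using \<open>0 < 1 - \<epsilon>\<close> by (simp add: field_simps)
    also have "\<dots> \<le> \<epsilon> / (1 - e)" using \<epsilon> by (intro divide_left_mono) auto
    finally have "- ln (1 - \<epsilon>) \<le> \<epsilon> / (1 - e)" using \<open>0 < 1 - \<epsilon>\<close> by (simp add: ln_div)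
    then have "- ln (1 - \<epsilon>) / ln 2 \<le> \<epsilon> / (1 - e) / ln 2"
      by (intro divide_right_mono) auto
    then show ?thesis by (simp add: log_def)
  qed
  have plain: "l - log 2 \<epsilon> = l + n * \<mu>" by (simp add: \<epsilon>_def)
  have prob: "measure_pmf.prob (replicate_pmf n pX) (- low_entropy n R) * (l + n * \<mu>) \<le> c * \<epsilon> * (l + n * \<mu>)"
  proof (intro mult_right_mono)
    have "real (n + 1) ^ CARD('a) * \<epsilon> \<le> c * \<epsilon>"
      using c \<epsilon> by (intro mult_right_mono) auto
    then show "measure_pmf.prob (replicate_pmf n pX) (- low_entropy n R) \<le> c * \<epsilon>"
      by (rule order.trans[OF prob_not_low_entropy_le[OF n \<mu>(2), folded \<epsilon>_def]])
  qed (use \<mu>(1) in auto)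
  have "Delta_MI n \<Phi> pX pK \<le> ?\<kappa> + 1 / ((1 - e) * ln 2) * \<epsilon> + c * \<epsilon> * (l + n * \<mu>)"
    using le[unfolded plain] log prob by linarith
  also have "\<dots> = (c * (m + 2 * c\<^sup>2 / ln 2) + 1 / ((1 - e) * ln 2) + c * (l + n * \<mu>)) * \<epsilon>"
    by (simp only: ring_distribs mult_ac)
  finally show ?thesis
    by (simp only: \<epsilon>_def e_def)
qed

end

text \<open>The logarithmic summand in \<open>m\<close> makes room for the polynomial number of
  types, so that all low-entropy sequences can be indexed. The hash is chosen balanced on all type
  classes simultaneously.\<close>

lemma exists_hash_encryption:
  fixes R :: real and n :: nat
  assumes "0 < R" "0 < n"
  defines "m \<equiv> nat \<lceil>n * R + CARD('a) * log 2 (n + 1)\<rceil>"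
  shows "\<exists>h f (g :: 'a :: finite list \<Rightarrow> bool list).
    hash_encryption n m (n * CARD('a)) R (real (n + 1) ^ CARD('a)) h f g"
proof -
  let ?B = "{y :: bool list. length y = m}"
  let ?A = "{xs :: 'a list. length xs = n}"
  let ?I = "{M :: 'a multiset. size M = n}"
  define r where "r = n * R + CARD('a) * log 2 (real n + 1)"
  have r: "0 \<le> r" unfolding r_def using assms(1) by simp
  have m: "r \<le> m" "real m \<le> r + 1"
    using r unfolding m_def r_def by (simp_all add: add.commute) linarith+
  have B: "finite ?B" "?B \<noteq> {}" using Ex_list_of_length by auto
  obtain h where h: "h ` ?A \<subseteq> ?B"
    "\<And>M. M \<in> ?I \<Longrightarrow> fibre_deviation ?B {xs. mset xs = M} h \<le> real (card ?I) * card {xs. mset xs = M}"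
    by (rule exists_balanced_hash[of ?A ?B ?I "\<lambda>M. {xs. mset xs = M}"])
      (use B finite_multisets_of_size_UNIV in auto)
  have "card (low_entropy n R :: 'a list set) \<le> card ?B"
    using card_low_entropy_le_2_pow[OF assms(2), of R m, where 'a = 'a] m(1)
    by (simp add: r_def card_lists_of_length add.commute)
  moreover have "finite (low_entropy n R :: 'a list set)"
    by (rule finite_subset[of _ ?A]) (auto simp: low_entropy_def)
  ultimately obtain f where f: "f ` (low_entropy n R :: 'a list set) \<subseteq> ?B" "inj_on f (low_entropy n R)"
    using card_le_inj B by metis
  \<comment> \<open>One letter fits into \<open>CARD('a)\<close> bits because
    \<open>d < 2 ^ d\<close>. This crude length suffices, as plain codewords are exponentially
    rare.\<close>
  have "card ?A \<le> card {y :: bool list. length y = n * CARD('a)}"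
    by (simp add: card_lists_of_length mult.commute[of n] power_mult power_mono less_imp_le)
  then obtain g where g: "g ` ?A \<subseteq> {y :: bool list. length y = n * CARD('a)}" "inj_on g ?A"
    using card_le_inj[of ?A "{y :: bool list. length y = n * CARD('a)}"] by auto
  have "hash_encryption n m (n * CARD('a)) R (real (n + 1) ^ CARD('a)) h f g"
  proof
    fix M :: "'a multiset" assume M: "size M = n"
    have "real (card ?I) \<le> real ((n + 1) ^ CARD('a))"
      using card_multisets_of_size_UNIV_le[where 'a = 'a] by (intro of_nat_mono)
    then have "real (card ?I) * card {xs. mset xs = M} \<le> real (n + 1) ^ CARD('a) * card {xs. mset xs = M}"
      by (intro mult_right_mono) (simp_all only: of_nat_power of_nat_0_le_iff)
    then show "fibre_deviation ?B {xs. mset xs = M} h \<le> real (n + 1) ^ CARD('a) * card {xs. mset xs = M}"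
      using h(2)[of M] M by simp
  next
    have "(2::real) ^ m = 2 powr m" by (simp add: powr_realpow)
    \<comment> \<open>Rounding up to an integer costs less than one bit, hence the factor 2.\<close>
    also have "\<dots> \<le> 2 powr (r + 1)" using m(2) by simp
    also have "\<dots> = 2 * 2 powr (CARD('a) * log 2 (real n + 1)) * 2 powr (n * R)"
      by (simp add: r_def powr_add)
    also have "2 powr (CARD('a) * log 2 (real n + 1)) = (2 powr log 2 (real n + 1)) powr CARD('a)"
      by (simp only: powr_powr mult.commute)
    also have "\<dots> = real (n + 1) ^ CARD('a)"
      by (simp add: powr_realpow add.commute)
    finally show "2 ^ m \<le> 2 * real (n + 1) ^ CARD('a) * 2 powr (n * R)" .
  qed (use assms h(1) f g in auto)
  then show ?thesis by blast
qed

section \<open>Asymptotics\<close>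

text \<open>The maps are chosen before \<open>pX\<close>, \<open>pK\<close> and \<mu> are
  quantified. Everything but the exponential is collected into one polynomial in \<open>n\<close>
  with a coefficient depending on \<mu>.\<close>

lemma exists_universal_scheme:
  fixes R :: real and n :: nat
  assumes R: "0 < R" and n: "0 < n"
  defines "d \<equiv> CARD('a :: finite)"
  shows "\<exists>(\<Phi> :: 'a list \<Rightarrow> 'a list \<Rightarrow> bool list) \<Psi>. is_scheme n \<Phi> \<Psi> \<and>
    (\<forall>pX pK (\<mu> :: real). 0 < \<mu> \<longrightarrow> ereal \<mu> \<le> exponent_E R pX \<longrightarrow> ereal \<mu> \<le> exponent_F R pK \<longrightarrow>
      avg_length n \<Phi> pX pK \<le> 2 + n * R + d * log 2 (real n + 1) +
        n * d * ((real n + 1) ^ d * 2 powr (- real n * \<mu>)) \<and>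
      Delta_MI n \<Phi> pX pK \<le> (R + 2 * real d + 1 + 2 / ln 2 + 1 / ((1 - 2 powr - \<mu>) * ln 2) + \<mu>) *
        (real n + 1) ^ (3 * d + 1) * 2 powr (- real n * \<mu>))"
proof -
  define m where "m = nat \<lceil>n * R + CARD('a) * log 2 (n + 1)\<rceil>"
  define N where "N = (real n + 1) ^ d"
  obtain h f and g :: "'a list \<Rightarrow> bool list" where
    "hash_encryption n m (n * CARD('a)) R (real (n + 1) ^ CARD('a)) h f g"
    using exists_hash_encryption[OF R n, where 'a = 'a] unfolding m_def by blast
  then interpret hash_encryption n m "n * d" R N h f g
    by (simp add: N_def d_def add.commute)
  have r: "0 \<le> n * R + d * log 2 (real n + 1)" using R by simp
  then have m: "m \<le> n * R + d * log 2 (real n + 1) + 1"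
    unfolding m_def d_def by (simp add: add.commute) linarith
  have N1: "1 \<le> N" unfolding N_def by (rule one_le_power) simp
  \<comment> \<open>A crude bound that makes \<open>m\<close> at most linear in
    \<open>n\<close>.\<close>
  have "log 2 (real n + 1) \<le> real n"
  proof -
    have "real n + 1 \<le> 2 ^ n" using of_nat_mono[OF Suc_leI[OF less_exp[of n]], where 'a = real] by simp
    then have "log 2 (real n + 1) \<le> log 2 (2 ^ n)" by (intro log_mono) auto
    then show ?thesis by simp
  qed
  then have "d * log 2 (real n + 1) \<le> d * real n" by (intro mult_left_mono) auto
  then have m': "real m \<le> (R + d + 1) * (real n + 1)"
    using m R by (simp add: algebra_simps)
  show ?thesis
  proof (intro exI[of _ \<Phi>] exI[of _ "decrypt n \<Phi>"] conjI allI impI is_scheme)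
    fix pX pK :: "'a pmf" and \<mu> :: real
    assume \<mu>: "0 < \<mu>" "ereal \<mu> \<le> exponent_E R pX" "ereal \<mu> \<le> exponent_F R pK"
    \<comment> \<open>The constant 2 is the flag bit together with the rounding in
      \<open>m\<close>.\<close>
    show "avg_length n \<Phi> pX pK \<le> 2 + n * R + d * log 2 (real n + 1) +
        n * d * ((real n + 1) ^ d * 2 powr (- real n * \<mu>))"
      using avg_length_le[OF \<mu>(2), of pK] m by (simp add: N_def)
    define C where "C = 1 / ((1 - 2 powr - \<mu>) * ln 2)"
    have C: "0 \<le> C"
      using powr_less_mono[of "- \<mu>" 0 2] \<mu>(1) by (simp add: C_def)
    \<comment> \<open>The cube comes from the term with \<open>N * N\<^sup>2\<close> in the
      divergence of the hashed key, the factor \<open>n + 1\<close> from the quantities linear in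
      \<open>n\<close>: \<open>m\<close>, the plain length and \<open>n * \<mu>\<close>.\<close>
    have bracket: "N * (m + 2 * N\<^sup>2 / ln 2) + C + N * (real (n * d) + n * \<mu>) \<le>
        (R + 2 * real d + 1 + 2 / ln 2 + C + \<mu>) * (N ^ 3 * (real n + 1))"
    proof -
      define L where "L = 2 / ln (2 :: real)"
      have NN: "N \<le> N ^ 3" using power_increasing[of 1 3 N] N1 by simp
      have N3: "1 \<le> N ^ 3" using N1 by (rule one_le_power)
      have "N * m \<le> N ^ 3 * ((R + d + 1) * (real n + 1))"
        using NN m' N1 by (intro mult_mono) auto
      moreover have "L * N ^ 3 * 1 \<le> L * N ^ 3 * (real n + 1)"
        using N1 by (intro mult_left_mono) (auto simp: L_def)
      moreover have "C * 1 \<le> C * (N ^ 3 * (real n + 1))"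
        using mult_mono[OF N3, of 1 "real n + 1"] N1 N3 C by (intro mult_left_mono) auto
      moreover have "N * ((d + \<mu>) * n) \<le> N ^ 3 * ((d + \<mu>) * (real n + 1))"
      proof (rule mult_mono[OF NN])
        show "(d + \<mu>) * n \<le> (d + \<mu>) * (real n + 1)"
          using \<mu>(1) by (intro mult_left_mono) auto
      qed (use N1 \<mu>(1) in auto)
      ultimately have "N * m + L * N ^ 3 * 1 + C * 1 + N * ((d + \<mu>) * n) \<le>
          N ^ 3 * ((R + d + 1) * (real n + 1)) + L * N ^ 3 * (real n + 1) + C * (N ^ 3 * (real n + 1)) +
          N ^ 3 * ((d + \<mu>) * (real n + 1))"
        by (intro add_mono)
      also have "\<dots> = (R + 2 * real d + 1 + L + C + \<mu>) * (N ^ 3 * (real n + 1))"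
        by algebra
      also have "N * m + L * N ^ 3 * 1 + C * 1 + N * ((d + \<mu>) * n) =
          N * (m + L * N\<^sup>2) + C + N * (real (n * d) + n * \<mu>)"
        unfolding of_nat_mult by algebra
      finally show ?thesis by (simp add: L_def)
    qed
    have "N ^ 3 * (real n + 1) = (real n + 1) ^ (3 * d + 1)"
      by (simp add: N_def power_mult[symmetric] mult.commute)
    then show "Delta_MI n \<Phi> pX pK \<le> (R + 2 * real d + 1 + 2 / ln 2 + 1 / ((1 - 2 powr - \<mu>) * ln 2) + \<mu>) *
        (real n + 1) ^ (3 * d + 1) * 2 powr (- real n * \<mu>)"
      using order.trans[OF Delta_MI_le_exponent[OF \<mu>, folded C_def] mult_right_mono[OF bracket]]
      by (simp only: C_def mult.assoc powr_ge_zero)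
  qed
qed

lemma length_bound_tendsto:
  fixes R \<mu> :: real and d :: nat
  assumes "0 < \<mu>"
  shows "(\<lambda>n. 1 / real n * (2 + n * R + d * log 2 (real n + 1) +
    n * d * ((real n + 1) ^ d * 2 powr (- real n * \<mu>)))) \<longlonglongrightarrow> R"
proof -
  have "(\<lambda>n. (real n + 1) powr d * 2 powr (- real n * \<mu>)) \<longlonglongrightarrow> 0"
    using assms by real_asymp
  then have 1: "(\<lambda>n. (real n + 1) ^ d * 2 powr (- real n * \<mu>)) \<longlonglongrightarrow> 0"
    by (simp add: powr_realpow add_pos_nonneg)
  have 2: "(\<lambda>n. 2 / real n) \<longlonglongrightarrow> 0" "(\<lambda>n. log 2 (real n + 1) / real n) \<longlonglongrightarrow> 0"
    by real_asymp+
  have "(\<lambda>n. 2 / real n + R + d * (log 2 (real n + 1) / real n) +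
      d * ((real n + 1) ^ d * 2 powr (- real n * \<mu>))) \<longlonglongrightarrow> 0 + R + real d * 0 + real d * 0"
    by (intro tendsto_add tendsto_mult tendsto_const 1 2)
  then have "(\<lambda>n. 2 / real n + R + d * (log 2 (real n + 1) / real n) +
      d * ((real n + 1) ^ d * 2 powr (- real n * \<mu>))) \<longlonglongrightarrow> R"
    by (simp only: mult_zero_right add_0_left add_0_right)
  then show ?thesis
  proof (rule Lim_transform_eventually)
    show "\<forall>\<^sub>F n in sequentially. 2 / real n + R + d * (log 2 (real n + 1) / real n) +
        d * ((real n + 1) ^ d * 2 powr (- real n * \<mu>)) = 1 / real n * (2 + n * R +
        d * log 2 (real n + 1) + n * d * ((real n + 1) ^ d * 2 powr (- real n * \<mu>)))"
      using eventually_gt_at_top[of 0] by eventually_elim (simp add: field_simps)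
  qed
qed

text \<open>After taking logarithms and dividing by \<open>n\<close>, the constant and the
  polynomial factor contribute terms that tend to 0.\<close>

lemma liminf_neg_log2_ge:
  fixes K \<mu> :: real and p :: nat
  assumes K: "0 < K" and \<Delta>: "\<And>n. 0 < n \<Longrightarrow> 0 \<le> \<Delta> n"
    "\<And>n. 0 < n \<Longrightarrow> \<Delta> n \<le> K * (real n + 1) ^ p * 2 powr (- real n * \<mu>)"
  shows "ereal \<mu> \<le> liminf (\<lambda>n. ereal (1 / real n) * neg_log2 (\<Delta> n))"
proof -
  let ?g = "\<lambda>n. \<mu> - log 2 K / real n - p * (log 2 (real n + 1) / real n)"
  have "(\<lambda>n. log 2 K / real n) \<longlonglongrightarrow> 0" "(\<lambda>n. log 2 (real n + 1) / real n) \<longlonglongrightarrow> 0"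
    by real_asymp+
  then have "?g \<longlonglongrightarrow> \<mu> - 0 - real p * 0"
    by (intro tendsto_diff tendsto_mult tendsto_const)
  then have "liminf (\<lambda>n. ereal (?g n)) = ereal \<mu>"
    by (intro lim_imp_Liminf) auto
  moreover have "liminf (\<lambda>n. ereal (?g n)) \<le> liminf (\<lambda>n. ereal (1 / real n) * neg_log2 (\<Delta> n))"
  proof (intro Liminf_mono)
    show "\<forall>\<^sub>F n in sequentially. ereal (?g n) \<le> ereal (1 / real n) * neg_log2 (\<Delta> n)"
      using eventually_gt_at_top[of 0]
    proof eventually_elim
      case (elim n)
      show ?case
      proof (cases "\<Delta> n = 0")
        \<comment> \<open>Zero leakage gives the value \<infinity>, which exceeds any real
          bound.\<close>
        case True
        then show ?thesis using elim by (simp add: neg_log2_def)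
      next
        case False
        then have pos: "0 < \<Delta> n" using \<Delta>(1)[OF elim] by simp
        then have "log 2 (\<Delta> n) \<le> log 2 (K * (real n + 1) ^ p * 2 powr (- real n * \<mu>))"
          using \<Delta>(2)[OF elim] by (intro log_mono) auto
        also have "\<dots> = log 2 K + p * log 2 (real n + 1) - n * \<mu>"
          using K by (simp add: log_mult log_nat_power)
        finally have "1 / real n * (n * \<mu> - log 2 K - p * log 2 (real n + 1)) \<le> 1 / real n * (- log 2 (\<Delta> n))"
          by (intro mult_left_mono) auto
        moreover have "1 / real n * (n * \<mu> - log 2 K - p * log 2 (real n + 1)) = ?g n"
          using elim by (simp add: field_simps)
        ultimately show ?thesis using False by (simp add: neg_log2_def)
      qed
    qed
  qed
  ultimately show ?thesis by simp
qed

theorem corollary1: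
  fixes R :: real
  assumes "R > 0"
  shows "\<exists>(\<Phi> :: nat \<Rightarrow> 'a :: {finite, field} list \<Rightarrow> 'a list \<Rightarrow> bool list)
          (\<Psi> :: nat \<Rightarrow> 'a list \<Rightarrow> bool list \<Rightarrow> 'a list).
    (\<forall>n\<ge>1. is_scheme n (\<Phi> n) (\<Psi> n)) \<and>
    (\<forall>pX pK :: 'a pmf.
       shannon_entropy pX < R \<and> R < shannon_entropy pK \<longrightarrow>
         limsup (\<lambda>n. ereal (1 / real n * avg_length n (\<Phi> n) pX pK)) \<le> ereal R \<and>
         liminf (\<lambda>n. ereal (1 / real n) * neg_log2 (Delta_MI n (\<Phi> n) pX pK))
           \<ge> min (exponent_E R pX) (exponent_F R pK) \<and>
         min (exponent_E R pX) (exponent_F R pK) > 0)"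
proof -
  define d where "d = CARD('a)"
  define len :: "nat \<Rightarrow> real \<Rightarrow> real" where "len n \<mu> = 2 + n * R + d * log 2 (real n + 1) +
    n * d * ((real n + 1) ^ d * 2 powr (- real n * \<mu>))" for n \<mu>
  define K where "K \<mu> = R + 2 * real d + 1 + 2 / ln 2 + 1 / ((1 - 2 powr - \<mu>) * ln 2) + \<mu>" for \<mu> :: real
  \<comment> \<open>The guard \<open>0 < n\<close> lets the pairs be chosen for all natural numbers
    at once, including 0.\<close>
  have ex: "\<exists>\<Phi> \<Psi>. 0 < n \<longrightarrow> is_scheme n \<Phi> \<Psi> \<and>
    (\<forall>(pX :: 'a pmf) pK (\<mu> :: real). 0 < \<mu> \<longrightarrow> ereal \<mu> \<le> exponent_E R pX \<longrightarrow> ereal \<mu> \<le> exponent_F R pK \<longrightarrow>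
      avg_length n \<Phi> pX pK \<le> len n \<mu> \<and>
      Delta_MI n \<Phi> pX pK \<le> K \<mu> * (real n + 1) ^ (3 * d + 1) * 2 powr (- real n * \<mu>))" for n
  proof (cases "0 < n")
    case True
    then show ?thesis
      using exists_universal_scheme[OF assms True, where 'a = 'a] unfolding len_def K_def d_def by simp
  qed simp
  obtain \<Phi> \<Psi> where *: "\<And>n. 0 < n \<longrightarrow> is_scheme n (\<Phi> n) (\<Psi> n) \<and>
    (\<forall>(pX :: 'a pmf) pK (\<mu> :: real). 0 < \<mu> \<longrightarrow> ereal \<mu> \<le> exponent_E R pX \<longrightarrow> ereal \<mu> \<le> exponent_F R pK \<longrightarrow>
      avg_length n (\<Phi> n) pX pK \<le> len n \<mu> \<and>
      Delta_MI n (\<Phi> n) pX pK \<le> K \<mu> * (real n + 1) ^ (3 * d + 1) * 2 powr (- real n * \<mu>))"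
    using that[OF someI_ex[OF someI_ex[OF ex]]] .
  then have scheme: "\<And>n. 0 < n \<Longrightarrow> is_scheme n (\<Phi> n) (\<Psi> n)"
    and len: "\<And>n (pX :: 'a pmf) pK (\<mu> :: real). \<lbrakk>0 < n; 0 < \<mu>; ereal \<mu> \<le> exponent_E R pX; ereal \<mu> \<le> exponent_F R pK\<rbrakk> \<Longrightarrow>
      avg_length n (\<Phi> n) pX pK \<le> len n \<mu>"
    and MI: "\<And>n (pX :: 'a pmf) pK (\<mu> :: real). \<lbrakk>0 < n; 0 < \<mu>; ereal \<mu> \<le> exponent_E R pX; ereal \<mu> \<le> exponent_F R pK\<rbrakk> \<Longrightarrow>
      Delta_MI n (\<Phi> n) pX pK \<le> K \<mu> * (real n + 1) ^ (3 * d + 1) * 2 powr (- real n * \<mu>)"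
    by blast+
  show ?thesis
  proof (intro exI[of _ \<Phi>] exI[of _ \<Psi>] conjI allI impI)
    show "is_scheme n (\<Phi> n) (\<Psi> n)" if "1 \<le> n" for n
      using scheme that by simp
    fix pX pK :: "'a pmf"
    assume H: "shannon_entropy pX < R \<and> R < shannon_entropy pK"
    show pos: "0 < min (exponent_E R pX) (exponent_F R pK)"
      using exponent_E_pos[of pX R] exponent_F_pos[of R pK] H by simp
    \<comment> \<open>Evaluating the objective at \<open>pK\<close> itself shows that
      \<open>exponent_F\<close> is finite. Hence the minimum is a real number even if
      \<open>exponent_E\<close> is infinite, and the bounds can be applied with \<mu> equal to the
      minimum.\<close>
    have "exponent_F R pK \<le> ereal (max 0 (shannon_entropy pK - R)) + rel_entropy pK pK"
      unfolding exponent_F_def by (rule INF_lower) simp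
    also have "\<dots> < \<infinity>"
      by (simp only: rel_entropy_same add_0_right less_ereal.simps)
    finally have "min (exponent_E R pX) (exponent_F R pK) \<noteq> \<infinity>"
      by (auto simp: min_def)
    with pos obtain \<mu> where \<mu>: "min (exponent_E R pX) (exponent_F R pK) = ereal \<mu>"
      by (cases "min (exponent_E R pX) (exponent_F R pK)") auto
    have \<mu>0: "0 < \<mu>" using pos unfolding \<mu> by simp
    have \<mu>E: "ereal \<mu> \<le> exponent_E R pX" and \<mu>F: "ereal \<mu> \<le> exponent_F R pK"
      unfolding \<mu>[symmetric] by simp_all
    have "limsup (\<lambda>n. ereal (1 / real n * avg_length n (\<Phi> n) pX pK)) \<le>
        limsup (\<lambda>n. ereal (1 / real n * len n \<mu>))"
    proof (intro Limsup_mono)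
      show "\<forall>\<^sub>F n in sequentially. ereal (1 / real n * avg_length n (\<Phi> n) pX pK) \<le> ereal (1 / real n * len n \<mu>)"
        using eventually_gt_at_top[of 0]
      proof eventually_elim
        case (elim n)
        then show ?case
          using len[OF elim \<mu>0 \<mu>E \<mu>F] by (simp add: divide_right_mono)
      qed
    qed
    also have "\<dots> = ereal R"
      using length_bound_tendsto[OF \<mu>0, of R d]
      by (intro lim_imp_Limsup) (auto simp: len_def)
    finally show "limsup (\<lambda>n. ereal (1 / real n * avg_length n (\<Phi> n) pX pK)) \<le> ereal R" .
    have "0 < (1 - 2 powr - \<mu>) * ln 2"
      using powr_less_mono[of "- \<mu>" 0 2] \<mu>0 by simp
    then have "0 < 1 / ((1 - 2 powr - \<mu>) * ln 2)" by simp
    moreover have "0 < 2 / ln (2 :: real)" by simp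
    ultimately have "0 < K \<mu>"
      unfolding K_def using assms \<mu>0 by linarith
    then show "min (exponent_E R pX) (exponent_F R pK) \<le>
        liminf (\<lambda>n. ereal (1 / real n) * neg_log2 (Delta_MI n (\<Phi> n) pX pK))"
      unfolding \<mu> using MI[OF _ \<mu>0 \<mu>E \<mu>F] Delta_MI_nonneg by (intro liminf_neg_log2_ge)
  qed
qed

end
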